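(* Let $P$ be a finite poset of rank $n$ with a minimum element $\hat0_P$. Let $\widetilde{P}=P-\{\hat0_P,\hat1_P\}$ if $P$ is bounded (with maximum $\hat1_P$), and let $\widetilde{P}=P-\{\hat0_P\}$ if $P$ does not have a maximum element. Assume that $\widetilde{P}$ is doubly homotopy Cohen-Macaulay. Then for every $x\in\widetilde{P}$ the poset $(P\times\{\hat0,\hat1\})-\{(x,\hat0)\}$ is homotopy Cohen-Macaulay of rank $n+1$.
   Context: $\{\hat0,\hat1\}$ denotes the 2-element chain with $\hat0<\hat1$; $P\times Q$ is the direct product with $(a,b)\le(a',b')$ iff $a\le a'$ and $b\le b'$. The rank of a graded poset is the common length of its maximal chains. A poset is homotopy Cohen-Macaulay if its order complex $\Delta$ (simplicial complex of chains) is, i.e. for every face $F$ (including $\emptyset$) the link of $F$ in $\Delta$ is $(\dim\mathrm{link}_\Delta(F)-1)$-connected. A poset $R$ is doubly homotopy Cohen-Macaulay if $R$ is homotopy Cohen-Macaulay and for every $y\in R$ the poset $R-\{y\}$ is homotopy Cohen-Macaulay of the same rank as $R$. *)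

theory Defs
  imports "HOL-Analysis.Analysis"
begin

text \<open>
  A poset is a carrier set in a type of class \<open>order\<close>, so that a subposet is a subset.
  \<open>'a \<times> 'b\<close> carries the componentwise order (\<open>HOL-Library.Product_Order\<close>), and the type
  \<open>bool\<close> with \<open>False < True\<close> is the two-element chain.
\<close>

text \<open>A simplicial complex is its set of faces, including the empty face.\<close>

type_synonym 'a complex_faces = "'a set set"

definition order_complex :: "'a::order set \<Rightarrow> 'a complex_faces" where
  "order_complex P = {C. finite C \<and> pred_on.chain P (\<le>) C}"

definition link :: "'a complex_faces \<Rightarrow> 'a set \<Rightarrow> 'a complex_faces" where
  "link K F = {G \<in> K. F \<inter> G = {} \<and> F \<union> G \<in> K}"

text \<open>The complex whose only face is the empty one has dimension \<open>-1\<close>; hence the integers.\<close>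

definition complex_dim :: "'a complex_faces \<Rightarrow> int" where
  "complex_dim K = int (Max (card ` K)) - 1"

text \<open>
  Geometric realization in barycentric coordinates. The topology inherited from the product
  is the usual one for finite complexes, the only ones considered here.
\<close>

definition realization :: "'a complex_faces \<Rightarrow> ('a \<Rightarrow> real) topology" where
  "realization K = subtopology (powertop_real UNIV)
     {t. (\<forall>v. 0 \<le> t v) \<and> {v. t v \<noteq> 0} \<in> K \<and> sum t {v. t v \<noteq> 0} = 1}"

text \<open>
  The usual conventions for small \<open>k\<close>: \<open>(-1)\<close>-connected means nonempty, and every space is
  \<open>k\<close>-connected for \<open>k \<le> -2\<close>.
\<close>

definition k_connected :: "int \<Rightarrow> 'a topology \<Rightarrow> bool" where
  "k_connected k X \<longleftrightarrow>
     (-1 \<le> k \<longrightarrow> topspace X \<noteq> {}) \<and>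
     (\<forall>i::nat. int i \<le> k \<longrightarrow>
        (\<forall>f. continuous_map (nsphere i) X f \<longrightarrow>
           (\<exists>c. homotopic_with (\<lambda>_. True) (nsphere i) X f (\<lambda>_. c))))"

definition homotopy_CM_complex :: "'a complex_faces \<Rightarrow> bool" where
  "homotopy_CM_complex K \<longleftrightarrow>
     (\<forall>F\<in>K. k_connected (complex_dim (link K F) - 1) (realization (link K F)))"

definition homotopy_CM :: "'a::order set \<Rightarrow> bool" where
  "homotopy_CM P \<longleftrightarrow> homotopy_CM_complex (order_complex P)"

text \<open>
  \<open>P\<close> is graded of rank \<open>r\<close>. A chain of \<open>m\<close> elements has length \<open>m - 1\<close>; in particular the
  empty poset has rank \<open>-1\<close>, which differs from the rank \<open>0\<close> of a singleton.
\<close>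

definition has_rank :: "'a::order set \<Rightarrow> int \<Rightarrow> bool" where
  "has_rank P r \<longleftrightarrow> (\<forall>C. pred_on.maxchain P (\<le>) C \<longrightarrow> finite C \<and> int (card C) - 1 = r)"

definition doubly_homotopy_CM :: "'a::order set \<Rightarrow> bool" where
  "doubly_homotopy_CM R \<longleftrightarrow> homotopy_CM R \<and>
     (\<forall>y\<in>R. homotopy_CM (R - {y}) \<and> (\<exists>r. has_rank R r \<and> has_rank (R - {y}) r))"

definition has_minimum :: "'a::order set \<Rightarrow> bool" where
  "has_minimum P \<longleftrightarrow> (\<exists>b\<in>P. \<forall>y\<in>P. b \<le> y)"

definition has_maximum :: "'a::order set \<Rightarrow> bool" where
  "has_maximum P \<longleftrightarrow> (\<exists>t\<in>P. \<forall>y\<in>P. y \<le> t)"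

text \<open>Meaningful for posets with a minimum only.\<close>

definition reduced_poset :: "'a::order set \<Rightarrow> 'a set" where
  "reduced_poset P =
     (if has_maximum P then P - {LEAST y. y \<in> P, GREATEST y. y \<in> P}
      else P - {LEAST y. y \<in> P})"

end

theory Submission
  imports Defs
begin

text \<open>
  Let \<open>Q\<close> be the pruned product and \<open>F\<close> a chain of \<open>Q\<close>; its link is the order complex of the poset \<open>L\<close>
  of elements outside \<open>F\<close> comparable to all of \<open>F\<close>. If \<open>F\<close> misses the minimum of \<open>Q\<close>, or its maximum
  should there be one, then \<open>L\<close> has a cone point. Otherwise let \<open>p\<close> be the largest element of \<open>F\<close> on
  level 0 and \<open>q\<close> the smallest on level 1.

  If \<open>p = q\<close>, the projection to \<open>P\<close> identifies \<open>L\<close> with a link in the reduced poset \<open>R\<close> or in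
  \<open>R - {x}\<close>. If there is no \<open>q\<close>, or \<open>q = x\<close>, then \<open>(z, 0) \<le> (z, 1) \<ge> (p, 1)\<close> contracts \<open>L\<close>. In the
  remaining case the same contraction works for \<open>L\<close> without \<open>v = (q, 0)\<close>, while the link of \<open>v\<close> in \<open>L\<close> is
  again a link in \<open>R\<close> or \<open>R - {x}\<close>. So \<open>L\<close> arises from a contractible complex by attaching a cone over
  a highly connected one, which raises connectivity by one; joins are never needed.

  That last fact is proved directly: a sphere, taken as the boundary of a cube, is cut into a
  cubical grid so fine that each cell either avoids \<open>v\<close> or stays in its open star. On the latter
  cells the projection to the link of \<open>v\<close> is redefined cell by cell, by connectivity of the link,
  and the result is homotopic to the original map and avoids \<open>v\<close>.
\<close>

section \<open>Cubes and spheres\<close>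

text \<open>Recursion on the number of coordinates replaces a maximum over a set, so that bounds,
  scaling and continuity follow by induction. The start value 0 is neutral because absolute values
  are nonnegative.\<close>

fun sup_norm :: "nat \<Rightarrow> (nat \<Rightarrow> real) \<Rightarrow> real" where
  "sup_norm 0 x = 0"
| "sup_norm (Suc m) x = max (sup_norm m x) \<bar>x m\<bar>"

lemma abs_le_sup_norm: "k < m \<Longrightarrow> \<bar>x k\<bar> \<le> sup_norm m x"
  by (induction m) (auto simp: less_Suc_eq le_max_iff_disj)

lemma sup_norm_le_iff: "0 \<le> r \<Longrightarrow> sup_norm m x \<le> r \<longleftrightarrow> (\<forall>k<m. \<bar>x k\<bar> \<le> r)"
  by (induction m) (auto simp: less_Suc_eq)

lemma sup_norm_attained: "m > 0 \<Longrightarrow> \<exists>k<m. sup_norm m x = \<bar>x k\<bar>"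
proof (induction m)
  case (Suc m)
  show ?case
  proof (cases "m = 0 \<or> sup_norm m x \<le> \<bar>x m\<bar>")
    case True
    then show ?thesis by (intro exI[of _ m]) (auto simp: max_def)
  next
    case False
    then obtain k where "k < m" "sup_norm m x = \<bar>x k\<bar>" using Suc by auto
    then show ?thesis using False by (intro exI[of _ k]) auto
  qed
qed simp

lemma sup_norm_eqI:
  assumes "k < m" "\<bar>x k\<bar> = r" "\<And>k. k < m \<Longrightarrow> \<bar>x k\<bar> \<le> r"
  shows "sup_norm m x = r"
  using assms abs_le_sup_norm[of k m x] sup_norm_le_iff[of r m x] by force

lemma sup_norm_scale: "0 \<le> a \<Longrightarrow> sup_norm m (\<lambda>k. a * x k) = a * sup_norm m x"
  by (induction m) (auto simp: abs_mult max_mult_distrib_left)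

lemma continuous_on_sup_norm [continuous_intros]:
  assumes "continuous_on S f" shows "continuous_on S (\<lambda>y. sup_norm m (f y))"
proof (induction m)
  case (Suc m)
  moreover have "continuous_on S (\<lambda>y. f y m)"
    using assms by (rule continuous_on_product_then_coordinatewise)
  ultimately show ?case by (simp add: continuous_on_max continuous_on_rabs)
qed simp

definition cube :: "nat \<Rightarrow> (nat \<Rightarrow> real) set" where
  "cube m = {x. (\<forall>k\<ge>m. x k = 0) \<and> sup_norm m x \<le> 1}"

text \<open>The boundary is needed at radius 1, for filling in cubes, and at integer radius, where
  it is a union of cells of the integer grid. \<open>cube_frontier 0 1\<close> is empty, as befits
  the boundary of a point.\<close>

definition cube_frontier :: "nat \<Rightarrow> real \<Rightarrow> (nat \<Rightarrow> real) set" where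
  "cube_frontier m r = {x. (\<forall>k\<ge>m. x k = 0) \<and> sup_norm m x = r}"

section \<open>Radial projection between round spheres and cube boundaries\<close>

definition euclid_sphere :: "nat \<Rightarrow> (nat \<Rightarrow> real) set" where
  "euclid_sphere i = {x. (\<Sum>k\<le>i. (x k)\<^sup>2) = 1 \<and> (\<forall>k>i. x k = 0)}"

lemma nsphere_eq: "nsphere i = top_of_set (euclid_sphere i)"
  by (simp add: nsphere euclid_sphere_def euclidean_product_topology)

text \<open>Its inverse is \<open>to_cube i r\<close>, for positive \<open>r\<close>; the
  \<open>i\<close>-sphere is paired with the boundary of the cube in \<open>Suc i\<close>
  coordinates. Invariance under scaling lets one map on the sphere be viewed on cube boundaries of
  all sizes.\<close>

definition to_sphere :: "nat \<Rightarrow> (nat \<Rightarrow> real) \<Rightarrow> nat \<Rightarrow> real" where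
  "to_sphere i x = (\<lambda>k. x k / sqrt (\<Sum>k\<le>i. (x k)\<^sup>2))"

definition to_cube :: "nat \<Rightarrow> real \<Rightarrow> (nat \<Rightarrow> real) \<Rightarrow> nat \<Rightarrow> real" where
  "to_cube i r x = (\<lambda>k. (r / sup_norm (Suc i) x) * x k)"

lemma sum_squares_pos:
  assumes "sup_norm (Suc i) x > 0" shows "(\<Sum>k\<le>i. (x k)\<^sup>2) > 0"
proof -
  obtain k where "k \<le> i" "sup_norm (Suc i) x = \<bar>x k\<bar>"
    using sup_norm_attained[of "Suc i" x] by (auto simp: less_Suc_eq_le)
  then show ?thesis using assms by (intro sum_pos2[of _ k]) auto
qed

lemma sup_norm_pos:
  assumes "(\<Sum>k\<le>i. (x k)\<^sup>2) > 0" shows "sup_norm (Suc i) x > 0"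
proof (rule ccontr)
  assume "\<not> ?thesis"
  then have "sup_norm (Suc i) x \<le> 0" by simp
  then have "\<forall>k<Suc i. \<bar>x k\<bar> \<le> 0" using sup_norm_le_iff[of 0 "Suc i" x] by blast
  then have "(\<Sum>k\<le>i. (x k)\<^sup>2) = 0" by (intro sum.neutral) auto
  with assms show False by simp
qed

lemma to_sphere_in:
  assumes "sup_norm (Suc i) x > 0" "\<forall>k\<ge>Suc i. x k = 0"
  shows "to_sphere i x \<in> euclid_sphere i"
proof -
  have "(\<Sum>k\<le>i. (x k)\<^sup>2) > 0" by (rule sum_squares_pos) fact
  then show ?thesis using assms(2)
    by (simp add: euclid_sphere_def to_sphere_def power_divide less_imp_le flip: sum_divide_distrib)
qed

lemma continuous_on_to_sphere:
  "continuous_on {x. sup_norm (Suc i) x > 0} (to_sphere i)"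
  unfolding to_sphere_def
  by (intro continuous_intros continuous_on_product_then_coordinatewise[OF continuous_on_id])
    (use sum_squares_pos less_irrefl in fastforce)

lemma to_sphere_scale:
  assumes "a > 0" shows "to_sphere i (\<lambda>k. a * x k) = to_sphere i x"
  using assms
  by (simp add: to_sphere_def power_mult_distrib real_sqrt_mult flip: sum_distrib_left)

lemma to_cube_in:
  assumes "x \<in> euclid_sphere i" "r > 0" shows "to_cube i r x \<in> cube_frontier (Suc i) r"
proof -
  have "sup_norm (Suc i) x > 0" using assms by (intro sup_norm_pos) (simp add: euclid_sphere_def)
  then have "sup_norm (Suc i) (to_cube i r x) = r"
    unfolding to_cube_def using assms(2) by (subst sup_norm_scale) (auto simp del: sup_norm.simps)
  moreover have "to_cube i r x k = 0" if "k \<ge> Suc i" for k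
    using assms(1) that by (simp add: to_cube_def euclid_sphere_def del: sup_norm.simps)
  ultimately show ?thesis by (simp add: cube_frontier_def del: sup_norm.simps)
qed

lemma continuous_on_to_cube: "continuous_on (euclid_sphere i) (to_cube i r)"
proof -
  have "sup_norm (Suc i) x \<noteq> 0" if "x \<in> euclid_sphere i" for x
    using sup_norm_pos[of x i] that by (auto simp: euclid_sphere_def)
  then show ?thesis
    unfolding to_cube_def
    by (intro continuous_intros continuous_on_product_then_coordinatewise[OF continuous_on_id]) auto
qed

lemma to_sphere_to_cube:
  assumes "x \<in> euclid_sphere i" "r > 0" shows "to_sphere i (to_cube i r x) = x"
proof -
  have "sup_norm (Suc i) x > 0" using assms by (intro sup_norm_pos) (simp add: euclid_sphere_def)
  then have "to_sphere i (to_cube i r x) = to_sphere i x"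
    unfolding to_cube_def using assms by (intro to_sphere_scale) simp
  also have "\<dots> = x" using assms by (simp add: to_sphere_def euclid_sphere_def)
  finally show ?thesis .
qed

lemma to_cube_to_sphere:
  assumes "x \<in> cube_frontier (Suc i) r" "r > 0" shows "to_cube i r (to_sphere i x) = x"
proof -
  let ?s = "sqrt (\<Sum>k\<le>i. (x k)\<^sup>2)"
  have r: "sup_norm (Suc i) x = r" using assms by (simp add: cube_frontier_def)
  then have s: "?s > 0" using sum_squares_pos[of i x] assms by simp
  have "to_sphere i x = (\<lambda>k. (1/?s) * x k)" by (simp add: to_sphere_def)
  moreover have "sup_norm (Suc i) \<dots> = (1/?s) * r"
    using s by (subst sup_norm_scale) (auto simp: r simp del: sup_norm.simps)
  ultimately show ?thesis unfolding to_cube_def using s assms(2)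
    by (simp del: sup_norm.simps)
qed

lemma closed_cube_frontier: "closed (cube_frontier m r)"
proof -
  have "cube_frontier m r = (\<Inter>k\<in>{m..}. {x. x k = 0}) \<inter> {x. sup_norm m x = r}"
    by (auto simp: cube_frontier_def)
  moreover have "closed {x :: nat \<Rightarrow> real. x k = 0}" for k
    by (intro closed_Collect_eq continuous_on_product_coordinates continuous_on_const)
  moreover have "closed {x. sup_norm m x = r}"
    by (intro closed_Collect_eq continuous_on_sup_norm continuous_on_id continuous_on_const)
  ultimately show ?thesis by (simp add: closed_INT closed_Int)
qed

text \<open>Tychonoff: the box is a product of compact intervals. An interval may shrink to a point,
  which is how cubes and cells of finite dimension sit inside the space of all sequences.\<close>

lemma compact_Pi_intervals:
  fixes a b :: "'a \<Rightarrow> real"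
  shows "compact {y. \<forall>k. a k \<le> y k \<and> y k \<le> b k}"
proof -
  have "compactin (product_topology (\<lambda>i. euclidean) UNIV) (PiE UNIV (\<lambda>k. {a k..b k}))"
    by (subst compactin_PiE) auto
  moreover have "PiE UNIV (\<lambda>k. {a k..b k}) = {y. \<forall>k. a k \<le> y k \<and> y k \<le> b k}"
    by (auto simp: PiE_def Pi_def)
  ultimately show ?thesis by (simp add: euclidean_product_topology)
qed

lemma compact_cube_frontier: "compact (cube_frontier m r)"
proof -
  let ?B = "{y. \<forall>k. (if k < m then - r else 0) \<le> y k \<and> y k \<le> (if k < m then r else 0 :: real)}"
  have "cube_frontier m r \<subseteq> ?B"
  proof
    fix y assume y: "y \<in> cube_frontier m r"
    then have "\<bar>y k\<bar> \<le> r" if "k < m" for k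
      using abs_le_sup_norm[OF that, of y] by (simp add: cube_frontier_def)
    with y show "y \<in> ?B" by (auto simp: cube_frontier_def abs_le_iff minus_le_iff)
  qed
  moreover have "compact ?B" by (rule compact_Pi_intervals)
  ultimately show ?thesis
    using closed_cube_frontier compact_Int_closed[of ?B "cube_frontier m r"]
    by (simp add: inf.absorb2)
qed

lemma k_connected_top_of_set:
  "k_connected k (top_of_set S) \<longleftrightarrow>
     (-1 \<le> k \<longrightarrow> S \<noteq> {}) \<and>
     (\<forall>i f. int i \<le> k \<longrightarrow> continuous_on (euclid_sphere i) f \<longrightarrow> f \<in> euclid_sphere i \<rightarrow> S \<longrightarrow>
        (\<exists>c. homotopic_with_canon (\<lambda>_. True) (euclid_sphere i) S f (\<lambda>_. c)))"
  unfolding k_connected_def nsphere_eq by (simp add: conj_commute imp_conjL)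

text \<open>The boundary of an \<open>m\<close>-cube is an \<open>(m - 1)\<close>-sphere, so
  \<open>f\<close> is null-homotopic, and the null-homotopy read along the rays is the extension.
  For \<open>m = 0\<close> the boundary is empty and a point of \<open>S\<close> is enough.\<close>

lemma k_connected_imp_extends_over_cube:
  fixes S :: "'b::topological_space set"
  assumes S: "k_connected k (top_of_set S)" and m: "int m \<le> k + 1"
    and f: "continuous_on (cube_frontier m 1) f" "f \<in> cube_frontier m 1 \<rightarrow> S"
  shows "\<exists>g. continuous_on (cube m) g \<and> g \<in> cube m \<rightarrow> S \<and> (\<forall>x\<in>cube_frontier m 1. g x = f x)"
proof (cases m)
  case 0
  have "S \<noteq> {}" using S m 0 by (simp add: k_connected_top_of_set)
  then obtain s where "s \<in> S" by blast
  then show ?thesis using 0 by (intro exI[of _ "\<lambda>_. s"]) (auto simp: cube_frontier_def)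
next
  case (Suc i)
  have "continuous_on (euclid_sphere i) (f \<circ> to_cube i 1)"
    using f to_cube_in[of _ i 1] Suc
    by (intro continuous_on_compose continuous_on_to_cube)
      (auto intro: continuous_on_subset)
  moreover have "f \<circ> to_cube i 1 \<in> euclid_sphere i \<rightarrow> S"
    using f(2) to_cube_in[of _ i 1] Suc by auto
  ultimately obtain c where
    "homotopic_with_canon (\<lambda>_. True) (euclid_sphere i) S (f \<circ> to_cube i 1) (\<lambda>_. c)"
    using S m Suc unfolding k_connected_top_of_set by fastforce
  then obtain h :: "real \<times> (nat \<Rightarrow> real) \<Rightarrow> 'b" where h: "continuous_on ({0..1} \<times> euclid_sphere i) h"
    "h \<in> {0..1} \<times> euclid_sphere i \<rightarrow> S"
    and h0: "\<And>x. h (0, x) = f (to_cube i 1 x)" and h1: "\<And>x. h (1, x) = c"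
    unfolding homotopic_with_def by auto
  \<comment> \<open>The extension is constant on the inner half of the cube, which avoids a limit at the centre.\<close>
  define q where "q = (\<lambda>x. (2 * (1 - sup_norm m x), to_sphere i x))"
  define g where "g = (\<lambda>x. if sup_norm m x \<le> 1/2 then c else h (q x))"
  have q: "q x \<in> {0..1} \<times> euclid_sphere i" if "x \<in> cube m" "1/2 \<le> sup_norm m x" for x
    using that to_sphere_in[of i x] unfolding q_def Suc by (auto simp: cube_def simp del: sup_norm.simps)
  have "continuous_on {x \<in> cube m. 1/2 \<le> sup_norm m x} (\<lambda>x. h (q x))"
  proof (rule continuous_on_compose2[OF h(1)])
    show "continuous_on {x \<in> cube m. 1/2 \<le> sup_norm m x} q"
      unfolding q_def Suc
      by (intro continuous_intros continuous_on_subset[OF continuous_on_to_sphere]) force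
  qed (use q in blast)
  then have "continuous_on (cube m) g"
    unfolding g_def
  proof (intro continuous_on_cases_le)
    show "c = h (q x)" if "sup_norm m x = 1/2" for x
      unfolding q_def that using h1 by simp
    show "continuous_on (cube m) (sup_norm m)"
      by (rule continuous_on_sup_norm) (rule continuous_on_id)
  qed (rule continuous_on_const)
  moreover have "g \<in> cube m \<rightarrow> S"
  proof
    fix x assume x: "x \<in> cube m"
    \<comment> \<open>The sphere has a point, at which the final stage of \<open>h\<close> takes the
      value \<open>c\<close>; hence \<open>c\<close> lies in \<open>S\<close>.\<close>
    have "(\<lambda>k. if k = 0 then 1 else 0) \<in> euclid_sphere i"
      using in_topspace_nsphere[of i] by (simp add: nsphere_eq)
    then have "h (1, (\<lambda>k. if k = 0 then 1 else 0)) \<in> S"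
      by (intro funcset_mem[OF h(2)]) auto
    then have "c \<in> S" by (simp only: h1)
    moreover have "h (q x) \<in> S" if "\<not> sup_norm m x \<le> 1/2"
      using that by (intro funcset_mem[OF h(2)] q x) simp
    ultimately show "g x \<in> S" by (simp add: g_def)
  qed
  moreover have "g x = f x" if "x \<in> cube_frontier m 1" for x
    using that h0 to_cube_to_sphere[of x i 1] Suc
    by (simp add: g_def q_def cube_frontier_def)
  ultimately show ?thesis by blast
qed

section \<open>Extending maps over cubical grids\<close>

text \<open>A cell of the integer grid: \<open>c\<close> is its lowest corner, \<open>J\<close> the set of coordinates that vary.\<close>

definition cell :: "(nat \<Rightarrow> int) \<Rightarrow> nat set \<Rightarrow> (nat \<Rightarrow> real) set" where
  "cell c J = {y. \<forall>k. real_of_int (c k) \<le> y k \<and> y k \<le> real_of_int (c k) + (if k \<in> J then 1 else 0)}"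

definition cell_frontier :: "(nat \<Rightarrow> int) \<Rightarrow> nat set \<Rightarrow> (nat \<Rightarrow> real) set" where
  "cell_frontier c J = {y \<in> cell c J. \<exists>k\<in>J. y k = c k \<or> y k = c k + 1}"

lemma closed_cell: "closed (cell c J)"
  unfolding cell_def by (intro compact_imp_closed compact_Pi_intervals)

lemma cellD:
  "y \<in> cell c J \<Longrightarrow> real_of_int (c k) \<le> y k \<and> y k \<le> real_of_int (c k) + (if k \<in> J then 1 else 0)"
  by (simp add: cell_def)

lemma corner_in_cell: "(\<lambda>k. real_of_int (c k)) \<in> cell c J"
  by (simp add: cell_def)

lemma cell_fixed_coordinate: "y \<in> cell c J \<Longrightarrow> k \<notin> J \<Longrightarrow> y k = c k"
  by (auto simp: cell_def intro: antisym dest!: spec[of _ k])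

lemma cell_mono_index:
  assumes "cell c' J' \<subseteq> cell c J" shows "J' \<subseteq> J"
proof
  fix k assume k: "k \<in> J'"
  have 1: "(\<lambda>k. real_of_int (c' k)) \<in> cell c J" using assms corner_in_cell by blast
  have "(\<lambda>j. real_of_int (c' j) + (if j = k then 1 else 0)) \<in> cell c' J'" using k by (simp add: cell_def)
  then have 2: "(\<lambda>j. real_of_int (c' j) + (if j = k then 1 else 0)) \<in> cell c J" using assms by blast
  show "k \<in> J"
  proof (rule ccontr)
    assume "k \<notin> J"
    then show False
      using cell_fixed_coordinate[OF 1] cell_fixed_coordinate[OF 2] by fastforce
  qed
qed

text \<open>Both extreme corners of the smaller cell lie in the larger one, which pins down
  \<open>c\<close>. With \<open>cell_mono_index\<close> it follows that every face other than the
  cell itself has a smaller index set.\<close>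

lemma cell_subset_same_index:
  assumes "cell c' J \<subseteq> cell c J" shows "c' = c"
proof
  fix k
  have 1: "(\<lambda>k. real_of_int (c' k)) \<in> cell c J" using assms corner_in_cell by blast
  have "(\<lambda>j. real_of_int (c' j) + (if j \<in> J then 1 else 0)) \<in> cell c' J" by (simp add: cell_def)
  then have 2: "(\<lambda>j. real_of_int (c' j) + (if j \<in> J then 1 else 0)) \<in> cell c J" using assms by blast
  show "c' k = c k"
  proof (cases "k \<in> J")
    case True
    with 1 2 have "real_of_int (c k) \<le> c' k" "real_of_int (c' k) \<le> c k" by (auto simp: cell_def)
    then show ?thesis by simp
  next
    case False
    then show ?thesis using cell_fixed_coordinate[OF 1] by force
  qed
qed

text \<open>A boundary point is extreme in some direction \<open>k\<close>. Freezing that coordinate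
  gives a facet through the point; its corner moves up by one in direction \<open>k\<close> if the
  value is the upper one.\<close>

lemma cell_frontier_subset_facets:
  assumes "y \<in> cell_frontier c J"
  shows "\<exists>k\<in>J. \<exists>c'. y \<in> cell c' (J - {k}) \<and> cell c' (J - {k}) \<subseteq> cell c J"
proof -
  from assms obtain k where y: "y \<in> cell c J" and k: "k \<in> J" "y k = c k \<or> y k = c k + 1"
    by (auto simp: cell_frontier_def)
  define c' where "c' = (if y k = c k then c else c(k := c k + 1))"
  have "y \<in> cell c' (J - {k})"
    unfolding cell_def
  proof (intro CollectI allI)
    fix j
    show "real_of_int (c' j) \<le> y j \<and> y j \<le> real_of_int (c' j) + (if j \<in> J - {k} then 1 else 0)"
      using cellD[OF y, of j] k by (auto simp: c'_def)
  qed
  moreover have "cell c' (J - {k}) \<subseteq> cell c J"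
  proof
    fix z assume z: "z \<in> cell c' (J - {k})"
    show "z \<in> cell c J"
      unfolding cell_def
    proof (intro CollectI allI)
      fix j
      show "real_of_int (c j) \<le> z j \<and> z j \<le> real_of_int (c j) + (if j \<in> J then 1 else 0)"
        using z k(1) unfolding cell_def c'_def mem_Collect_eq
        by (elim allE[of _ j]) (auto split: if_splits)
    qed
  qed
  ultimately show ?thesis using k by blast
qed

text \<open>In a direction of \<open>J\<close> the point lies strictly between consecutive integers,
  so any other cell through it spans the same unit interval there. In the remaining directions all
  points of \<open>cell c J\<close> agree with \<open>y\<close>.\<close>

lemma cell_subset_if_interior_point:
  assumes y: "y \<in> cell c J" "y \<notin> cell_frontier c J" "y \<in> cell c' J'"
  shows "cell c J \<subseteq> cell c' J'"
proof
  have J: "k \<in> J' \<and> c' k = c k" if "k \<in> J" for k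
  proof -
    have "real_of_int (c k) < y k" "y k < c k + 1"
      using y(1,2) that unfolding cell_frontier_def cell_def
      by (auto simp: order.order_iff_strict dest!: spec[of _ k])
    moreover have "real_of_int (c' k) \<le> y k" "y k \<le> real_of_int (c' k) + (if k \<in> J' then 1 else 0)"
      using y(3) by (auto simp: cell_def)
    ultimately have "real_of_int (c k) < c' k + (if k \<in> J' then 1 else 0)" "real_of_int (c' k) < c k + 1"
      by (cases "k \<in> J'"; simp)+
    then show ?thesis by (cases "k \<in> J'") auto
  qed
  fix z assume z: "z \<in> cell c J"
  show "z \<in> cell c' J'"
    unfolding cell_def
  proof (intro CollectI allI)
    fix k
    show "real_of_int (c' k) \<le> z k \<and> z k \<le> real_of_int (c' k) + (if k \<in> J' then 1 else 0)"
    proof (cases "k \<in> J")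
      case True
      then show ?thesis using cellD[OF z, of k] J[OF True] True by simp
    next
      case False
      then have "z k = y k" using y(1) z cell_fixed_coordinate by metis
      then show ?thesis using y(3) by (simp add: cell_def)
    qed
  qed
qed

text \<open>An affine change of coordinates turns the cell into a cube of dimension
  \<open>card J\<close>, where \<open>k_connected_imp_extends_over_cube\<close> applies.\<close>

lemma cell_frontier_extension:
  fixes S :: "'b::topological_space set"
  assumes S: "k_connected q (top_of_set S)" and J: "finite J" "int (card J) \<le> q + 1"
    and f: "continuous_on (cell_frontier c J) f" "f \<in> cell_frontier c J \<rightarrow> S"
  shows "\<exists>g. continuous_on (cell c J) g \<and> g \<in> cell c J \<rightarrow> S \<and> (\<forall>y\<in>cell_frontier c J. g y = f y)"
proof -
  define m where "m = card J"
  obtain e where e: "bij_betw e {..<m} J"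
    using ex_bij_betw_nat_finite[OF J(1)] by (auto simp: m_def atLeast0LessThan)
  define e' where "e' = inv_into {..<m} e"
  have e': "e' k < m" "e (e' k) = k" if "k \<in> J" for k
    using e that bij_betw_inv_into_right[OF e] inv_into_into[of k e "{..<m}"]
    by (auto simp: e'_def bij_betw_def)
  have e'': "e i \<in> J" "e' (e i) = i" if "i < m" for i
    using e that bij_betw_inv_into_left[OF e] by (auto simp: e'_def bij_betw_def)
  \<comment> \<open>\<open>e\<close> numbers the directions of \<open>J\<close>. \<alpha> carries
    the interval from -1 to 1 to the one from \<open>c k\<close> to \<open>c k + 1\<close>, and
    \<beta> goes back; the value 0 from \<open>m\<close> on places \<beta> in
    \<open>cube m\<close>.\<close>
  define \<alpha> where "\<alpha> = (\<lambda>x k. if k \<in> J then c k + (x (e' k) + 1) / 2 else real_of_int (c k))"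
  define \<beta> where "\<beta> = (\<lambda>y i. if i < m then 2 * (y (e i) - real_of_int (c (e i))) - 1 else 0)"
  have cont_\<alpha>: "continuous_on T \<alpha>" for T
    unfolding \<alpha>_def
  proof (rule continuous_on_coordinatewise_then_product)
    fix k show "continuous_on T (\<lambda>x. if k \<in> J then c k + (x (e' k) + 1) / 2 else real_of_int (c k))"
      by (cases "k \<in> J")
        (auto intro!: continuous_intros continuous_on_product_then_coordinatewise[OF continuous_on_id])
  qed
  have cont_\<beta>: "continuous_on T \<beta>" for T
    unfolding \<beta>_def
  proof (rule continuous_on_coordinatewise_then_product)
    fix i show "continuous_on T (\<lambda>y. if i < m then 2 * (y (e i) - real_of_int (c (e i))) - 1 else 0)"
      by (cases "i < m")
        (auto intro!: continuous_intros continuous_on_product_then_coordinatewise[OF continuous_on_id])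
  qed
  have \<alpha>_cell: "\<alpha> x \<in> cell_frontier c J" if x: "x \<in> cube_frontier m 1" for x
  proof -
    have x1: "\<bar>x i\<bar> \<le> 1" if "i < m" for i
      using abs_le_sup_norm[OF that, of x] x by (simp add: cube_frontier_def)
    have "\<alpha> x \<in> cell c J"
      unfolding cell_def
    proof (intro CollectI allI)
      fix k
      show "real_of_int (c k) \<le> \<alpha> x k \<and> \<alpha> x k \<le> real_of_int (c k) + (if k \<in> J then 1 else 0)"
        using x1[OF e'(1), of k] by (auto simp: \<alpha>_def abs_le_iff)
    qed
    moreover have "m > 0" using x by (cases m) (auto simp: cube_frontier_def)
    then obtain i where i: "i < m" "\<bar>x i\<bar> = 1"
      using sup_norm_attained[of m x] x by (auto simp: cube_frontier_def)
    then have "x i = 1 \<or> x i = -1" by linarith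
    then have "\<alpha> x (e i) = c (e i) \<or> \<alpha> x (e i) = c (e i) + 1"
      using e''[OF i(1)] by (auto simp: \<alpha>_def)
    ultimately show ?thesis using e''(1)[OF i(1)] by (auto simp: cell_frontier_def)
  qed
  have \<beta>1: "\<bar>\<beta> y i\<bar> \<le> 1" if "y \<in> cell c J" for y i
    using that e''[of i] unfolding cell_def \<beta>_def mem_Collect_eq
    by (auto simp: abs_le_iff dest!: spec[of _ "e i"])
  have \<beta>_cube: "\<beta> y \<in> cube m" if y: "y \<in> cell c J" for y
    using \<beta>1[OF y] by (simp add: cube_def sup_norm_le_iff) (simp add: \<beta>_def)
  have \<beta>_frontier: "\<beta> y \<in> cube_frontier m 1" if y: "y \<in> cell_frontier c J" for y
  proof -
    obtain k where k: "k \<in> J" "y k = c k \<or> y k = c k + 1" and yc: "y \<in> cell c J"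
      using y by (auto simp: cell_frontier_def)
    have "sup_norm m (\<beta> y) = 1"
    proof (rule sup_norm_eqI)
      show "e' k < m" using k e' by simp
      show "\<bar>\<beta> y (e' k)\<bar> = 1" using k e'[OF k(1)] by (auto simp: \<beta>_def)
    qed (rule \<beta>1[OF yc])
    then show ?thesis by (simp add: cube_frontier_def \<beta>_def)
  qed
  have \<alpha>\<beta>: "\<alpha> (\<beta> y) = y" if "y \<in> cell c J" for y
    using cell_fixed_coordinate[OF that] e' by (auto simp: \<alpha>_def \<beta>_def fun_eq_iff field_simps)
  have "\<exists>g. continuous_on (cube m) g \<and> g \<in> cube m \<rightarrow> S \<and> (\<forall>x\<in>cube_frontier m 1. g x = (f \<circ> \<alpha>) x)"
  proof (rule k_connected_imp_extends_over_cube[OF S])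
    show "continuous_on (cube_frontier m 1) (f \<circ> \<alpha>)"
      using \<alpha>_cell by (intro continuous_on_compose cont_\<alpha> continuous_on_subset[OF f(1)]) auto
    show "f \<circ> \<alpha> \<in> cube_frontier m 1 \<rightarrow> S" using \<alpha>_cell f(2) by auto
  qed (use J m_def in auto)
  then obtain g where g: "continuous_on (cube m) g" "g \<in> cube m \<rightarrow> S"
    and gf: "\<And>x. x \<in> cube_frontier m 1 \<Longrightarrow> g x = f (\<alpha> x)" by auto
  show ?thesis
  proof (intro exI[of _ "g \<circ> \<beta>"] conjI ballI)
    show "continuous_on (cell c J) (g \<circ> \<beta>)"
      using \<beta>_cube by (intro continuous_on_compose cont_\<beta> continuous_on_subset[OF g(1)]) auto
    show "g \<circ> \<beta> \<in> cell c J \<rightarrow> S" using \<beta>_cube g(2) by auto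
    show "(g \<circ> \<beta>) y = f y" if "y \<in> cell_frontier c J" for y
      using gf[OF \<beta>_frontier[OF that]] \<alpha>\<beta>[of y] that by (simp add: cell_frontier_def)
  qed
qed

section \<open>Subcomplexes of the grid\<close>

definition cells_union :: "((nat \<Rightarrow> int) \<times> nat set) set \<Rightarrow> (nat \<Rightarrow> real) set" where
  "cells_union F = (\<Union>(c, J)\<in>F. cell c J)"

text \<open>The condition for being a subcomplex, with faces recognized by inclusion of point sets
  instead of an incidence relation.\<close>

definition face_closed :: "((nat \<Rightarrow> int) \<times> nat set) set \<Rightarrow> bool" where
  "face_closed F \<longleftrightarrow> (\<forall>(c, J)\<in>F. \<forall>c' J'. cell c' J' \<subseteq> cell c J \<longrightarrow> (c', J') \<in> F)"

lemma face_closedD: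
  "face_closed F \<Longrightarrow> (c, J) \<in> F \<Longrightarrow> cell c' J' \<subseteq> cell c J \<Longrightarrow> (c', J') \<in> F"
  unfolding face_closed_def by blast

lemma face_closed_restrict:
  assumes "face_closed F" shows "face_closed {(c, J) \<in> F. \<forall>y\<in>cell c J. Q y}"
  unfolding face_closed_def using face_closedD[OF assms] by blast

lemma face_closed_Int: "face_closed F \<Longrightarrow> face_closed G \<Longrightarrow> face_closed (F \<inter> G)"
  unfolding face_closed_def by blast

lemma closed_cells_union: "finite F \<Longrightarrow> closed (cells_union F)"
  unfolding cells_union_def by (intro closed_UN) (auto simp: closed_cell)

text \<open>The cells outside \<open>A\<close> are added one by one in order of dimension, each by
  extension from its boundary. A cell of dimension at most \<open>q + 1\<close> has a boundary
  sphere of dimension at most \<open>q\<close>, so no obstruction arises.\<close>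

lemma cells_union_extension:
  fixes S :: "'b::topological_space set"
  assumes S: "k_connected q (top_of_set S)"
    and F: "finite F" "face_closed F" "\<And>c J. (c, J) \<in> F \<Longrightarrow> finite J \<and> int (card J) \<le> q + 1"
    and A: "A \<subseteq> F" "face_closed A"
    and f: "continuous_on (cells_union A) f" "f \<in> cells_union A \<rightarrow> S"
  shows "\<exists>g. continuous_on (cells_union F) g \<and> g \<in> cells_union F \<rightarrow> S \<and>
    (\<forall>y\<in>cells_union A. g y = f y)"
  using A f
proof (induction "card (F - A)" arbitrary: A f rule: less_induct)
  case (less A f)
  show ?case
  proof (cases "F = A")
    case True
    then show ?thesis using less.prems by blast
  next
    case False
    then have "F - A \<noteq> {}" using less.prems by blast
    \<comment> \<open>A missing cell of least dimension: all its proper faces are already in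
      \<open>A\<close>.\<close>
    then obtain D where D: "D \<in> F - A" "\<And>E. E \<in> F - A \<Longrightarrow> card (snd D) \<le> card (snd E)"
      using ex_has_least_nat[of "\<lambda>D. D \<in> F - A" _ "\<lambda>D. card (snd D)"] by blast
    obtain c J where cJ: "D = (c, J)" by (cases D)
    have J: "finite J" "int (card J) \<le> q + 1" using F(3)[of c J] D cJ by auto
    have small: "(c', J') \<in> insert D A" if "cell c' J' \<subseteq> cell c J" for c' J'
    proof (rule ccontr)
      assume *: "(c', J') \<notin> insert D A"
      have "(c', J') \<in> F" using face_closedD[OF F(2) _ that] D(1) cJ by simp
      then have "card J \<le> card J'" using D(2)[of "(c', J')"] * cJ by auto
      moreover have "J' \<subseteq> J" using that by (rule cell_mono_index)
      ultimately have "J' = J" using J(1) card_seteq by blast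
      then show False using * that cell_subset_same_index cJ by blast
    qed
    have closed_A': "face_closed (insert D A)"
      unfolding face_closed_def
    proof (clarify)
      fix c1 J1 c2 J2 assume *: "(c1, J1) \<in> insert D A" "cell c2 J2 \<subseteq> cell c1 J1"
        "(c2, J2) \<notin> A"
      then have "(c1, J1) = D" using face_closedD[OF less.prems(2) _ *(2)] by auto
      then show "(c2, J2) = D" using small *(2,3) cJ by auto
    qed
    \<comment> \<open>The new cell meets the old domain exactly in its boundary, since a common
      interior point would put the whole cell inside a cell of \<open>A\<close>, hence into
      \<open>A\<close>.\<close>
    have front: "cell c J \<inter> cells_union A = cell_frontier c J"
    proof (intro equalityI subsetI)
      fix y assume y: "y \<in> cell c J \<inter> cells_union A"
      then obtain c' J' where "(c', J') \<in> A" "y \<in> cell c' J'" by (auto simp: cells_union_def)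
      then show "y \<in> cell_frontier c J"
        using face_closedD[OF less.prems(2), of c' J' c J]
          cell_subset_if_interior_point[of y c J c' J'] y D(1) cJ by blast
    next
      fix y assume y: "y \<in> cell_frontier c J"
      then obtain k c' where k: "k \<in> J" "y \<in> cell c' (J - {k})" "cell c' (J - {k}) \<subseteq> cell c J"
        using cell_frontier_subset_facets by blast
      then have "(c', J - {k}) \<in> A" using small[OF k(3)] cJ by auto
      then show "y \<in> cell c J \<inter> cells_union A" using k by (auto simp: cells_union_def)
    qed
    have "continuous_on (cell_frontier c J) f" "f \<in> cell_frontier c J \<rightarrow> S"
      using less.prems(3,4) front by (auto intro: continuous_on_subset)
    then obtain g where g: "continuous_on (cell c J) g" "g \<in> cell c J \<rightarrow> S"
      "\<And>y. y \<in> cell_frontier c J \<Longrightarrow> g y = f y"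
      using cell_frontier_extension[OF S J] by metis
    define h where "h = (\<lambda>y. if y \<in> cells_union A then f y else g y)"
    have un: "cells_union (insert D A) = cells_union A \<union> cell c J"
      by (auto simp: cells_union_def cJ)
    have finA: "finite A" using less.prems(1) F(1) finite_subset by blast
    have agree: "f y = g y" if "y \<in> cell c J" "y \<in> cells_union A" for y
    proof -
      have "y \<in> cell_frontier c J" unfolding front[symmetric] using that by (rule IntI)
      then show ?thesis using g(3) by simp
    qed
    have 1: "continuous_on (cells_union (insert D A)) h"
      unfolding un h_def
      by (rule continuous_on_cases[OF closed_cells_union[OF finA] closed_cell less.prems(3) g(1)])
        (use agree in simp)
    have 2: "h \<in> cells_union (insert D A) \<rightarrow> S"
      unfolding un h_def using g(2) less.prems(4) by auto
    have "F - insert D A \<subset> F - A" using D by blast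
    then have "card (F - insert D A) < card (F - A)" using F(1) by (intro psubset_card_mono) auto
    moreover have "insert D A \<subseteq> F" using D(1) less.prems(1) by auto
    ultimately obtain g' where "continuous_on (cells_union F) g'" "g' \<in> cells_union F \<rightarrow> S"
      "\<forall>y\<in>cells_union (insert D A). g' y = h y"
      using less.hyps[OF _ _ closed_A' 1 2] by blast
    then show ?thesis by (intro exI[of _ g']) (auto simp: un h_def)
  qed
qed

text \<open>Integral coordinates are frozen and the others vary over their unit interval, which
  gives the smallest grid cell through \<open>y\<close>.\<close>

lemma in_min_cell: "y \<in> cell (\<lambda>k. \<lfloor>y k\<rfloor>) {k. y k \<notin> \<int>}"
  by (auto simp: cell_def Ints_def real_of_int_floor_add_one_ge)

lemma min_cell_subset:
  assumes "y \<in> cell c J" shows "cell (\<lambda>k. \<lfloor>y k\<rfloor>) {k. y k \<notin> \<int>} \<subseteq> cell c J"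
proof (rule cell_subset_if_interior_point[OF in_min_cell _ assms])
  show "y \<notin> cell_frontier (\<lambda>k. \<lfloor>y k\<rfloor>) {k. y k \<notin> \<int>}"
    by (auto simp: cell_frontier_def) (metis Ints_of_int, metis Ints_1 Ints_add Ints_of_int)
qed


text \<open>A common point determines its smallest cell, and face-closedness puts that cell into
  both families. Maps given on two subcomplexes can thus be compared on cells.\<close>

lemma cells_union_Int:
  assumes "face_closed A" "face_closed B"
  shows "cells_union (A \<inter> B) = cells_union A \<inter> cells_union B"
proof (intro equalityI subsetI)
  fix y assume "y \<in> cells_union A \<inter> cells_union B"
  then obtain c J c' J' where *: "(c, J) \<in> A" "y \<in> cell c J" "(c', J') \<in> B" "y \<in> cell c' J'"
    by (auto simp: cells_union_def)
  then have "(\<lambda>k. \<lfloor>y k\<rfloor>, {k. y k \<notin> \<int>}) \<in> A \<inter> B"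
    using assms min_cell_subset by (meson IntI face_closedD)
  then show "y \<in> cells_union (A \<inter> B)"
    unfolding cells_union_def using in_min_cell by blast
qed (auto simp: cells_union_def)

text \<open>The integer radius aligns the faces of the cube with the grid. The bound
  \<open>i\<close> on the dimension of the cells limits the connectivity required for extending maps
  over them.\<close>

lemma cube_frontier_grid:
  fixes N :: nat
  shows "\<exists>F. finite F \<and> face_closed F \<and> (\<forall>(c, J)\<in>F. finite J \<and> card J \<le> i) \<and>
    cells_union F = cube_frontier (Suc i) (real N)"
proof -
  let ?B = "cube_frontier (Suc i) (real N)"
  define F where "F = {(c, J). J \<subset> {..<Suc i} \<and> cell c J \<subseteq> ?B}"
  have "F \<subseteq> {c. \<forall>k. (k \<in> {..<Suc i} \<longrightarrow> c k \<in> {- int N..int N}) \<and> (k \<notin> {..<Suc i} \<longrightarrow> c k = 0)}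
      \<times> Pow {..<Suc i}"
  proof clarify
    fix c J assume "(c, J) \<in> F"
    then have J: "J \<subset> {..<Suc i}" and c: "(\<lambda>k. real_of_int (c k)) \<in> ?B"
      using corner_in_cell by (auto simp: F_def)
    have "c k \<in> {- int N..int N}" if "k < Suc i" for k
    proof -
      have "\<bar>real_of_int (c k)\<bar> \<le> real N"
        using abs_le_sup_norm[OF that, of "\<lambda>k. real_of_int (c k)"] c by (simp add: cube_frontier_def)
      then show ?thesis by auto
    qed
    then show "c \<in> {c. \<forall>k. (k \<in> {..<Suc i} \<longrightarrow> c k \<in> {- int N..int N}) \<and> (k \<notin> {..<Suc i} \<longrightarrow> c k = 0)}
        \<and> J \<in> Pow {..<Suc i}"
      using c J by (auto simp: cube_frontier_def)
  qed
  moreover have "finite ({c. \<forall>k. (k \<in> {..<Suc i} \<longrightarrow> c k \<in> {- int N..int N}) \<and> (k \<notin> {..<Suc i} \<longrightarrow> c k = 0)}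
      \<times> Pow {..<Suc i})"
    by (intro finite_cartesian_product finite_set_of_finite_funs) auto
  ultimately have "finite F" by (rule finite_subset)
  moreover have "face_closed F"
    unfolding face_closed_def
  proof clarify
    fix c J c' J' assume "(c, J) \<in> F" and sub: "cell c' J' \<subseteq> cell c J"
    then show "(c', J') \<in> F"
      using cell_mono_index[OF sub] unfolding F_def by blast
  qed
  moreover have "finite J \<and> card J \<le> i" if "(c, J) \<in> F" for c J
  proof -
    have J: "J \<subset> {..<Suc i}" using that by (simp add: F_def)
    then show ?thesis using psubset_card_mono[OF _ J] by (auto intro: finite_subset)
  qed
  moreover have "cells_union F = ?B"
  proof (intro equalityI subsetI)
    fix y assume y: "y \<in> ?B"
    let ?c = "\<lambda>k. \<lfloor>y k\<rfloor>" and ?J = "{k. y k \<notin> \<int>}"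
    have le: "\<bar>y k\<bar> \<le> real N" if "k < Suc i" for k
      using abs_le_sup_norm[OF that, of y] y by (simp add: cube_frontier_def)
    \<comment> \<open>Some coordinate of \<open>y\<close> is \<open>N\<close> or \<open>-N\<close>,
      hence integral and frozen in the smallest cell. This keeps the cell in the boundary and its
      index set proper.\<close>
    obtain k where k: "k < Suc i" "\<bar>y k\<bar> = real N"
      using sup_norm_attained[of "Suc i" y] y by (auto simp: cube_frontier_def simp del: sup_norm.simps)
    then have "y k = real N \<or> y k = - real N" by linarith
    then have kint: "y k \<in> \<int>" by (elim disjE) simp_all
    moreover have "?J \<subseteq> {..<Suc i}"
    proof
      fix j assume "j \<in> ?J"
      then have "y j \<noteq> 0" by auto
      then show "j \<in> {..<Suc i}" using y by (auto simp: cube_frontier_def not_less[symmetric])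
    qed
    ultimately have J: "?J \<subset> {..<Suc i}" using k by blast
    have "z \<in> ?B" if z: "z \<in> cell ?c ?J" for z
    proof -
      have z0: "z j = y j" if "y j \<in> \<int>" for j
        using cell_fixed_coordinate[OF z, of j] that by simp
      have "\<bar>z j\<bar> \<le> real N" if "j < Suc i" for j
      proof (cases "y j \<in> \<int>")
        case True
        then show ?thesis using z0 le[OF that] by simp
      next
        case False
        have "- int N \<le> \<lfloor>y j\<rfloor>" using le[OF that] by (simp add: le_floor_iff)
        moreover have "\<lfloor>y j\<rfloor> < int N"
        proof -
          have "y j \<noteq> real N" using False by auto
          then have "y j < real N" using le[OF that] by (simp add: abs_le_iff order.not_eq_order_implies_strict)
          then show ?thesis by (simp add: floor_less_iff)
        qed
        ultimately have "- real N \<le> real_of_int \<lfloor>y j\<rfloor>" "real_of_int \<lfloor>y j\<rfloor> + 1 \<le> real N"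
          by linarith+
        then show ?thesis using cellD[OF z, of j] False by (auto simp: abs_le_iff)
      qed
      moreover have "\<bar>z k\<bar> = real N" using k kint z0 by simp
      ultimately have "sup_norm (Suc i) z = real N" using k(1) by (intro sup_norm_eqI)
      moreover have "z j = 0" if "j \<ge> Suc i" for j
        using y that z0[of j] by (auto simp: cube_frontier_def)
      ultimately show ?thesis by (simp add: cube_frontier_def)
    qed
    then have "(?c, ?J) \<in> F" using J by (auto simp: F_def)
    then show "y \<in> cells_union F"
      unfolding cells_union_def using in_min_cell by blast
  qed (auto simp: cells_union_def F_def)
  ultimately show ?thesis by blast
qed

section \<open>Attaching a cone to a contractible complex\<close>

text \<open>The point set of \<open>realization K\<close>, to which \<open>contractible\<close> and
  \<open>homotopic_with_canon\<close>, stated for sets, apply directly.\<close>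

definition geom :: "'a complex_faces \<Rightarrow> ('a \<Rightarrow> real) set" where
  "geom K = {t. (\<forall>v. 0 \<le> t v) \<and> {v. t v \<noteq> 0} \<in> K \<and> sum t {v. t v \<noteq> 0} = 1}"

definition simplicial :: "'a complex_faces \<Rightarrow> bool" where
  "simplicial K \<longleftrightarrow> (\<forall>\<sigma>\<in>K. finite \<sigma> \<and> (\<forall>\<tau>\<subseteq>\<sigma>. \<tau> \<in> K))"

lemma realization_eq: "realization K = top_of_set (geom K)"
  by (simp add: realization_def geom_def euclidean_product_topology)

text \<open>Any face containing the support will do for \<sigma>, so that the exact support need not
  be computed.\<close>

lemma geomI:
  assumes "simplicial K" "\<sigma> \<in> K" "\<And>v. 0 \<le> t v" "\<And>v. v \<notin> \<sigma> \<Longrightarrow> t v = 0" "sum t \<sigma> = 1"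
  shows "t \<in> geom K"
proof -
  have sub: "{v. t v \<noteq> 0} \<subseteq> \<sigma>" using assms(4) by auto
  then have "{v. t v \<noteq> 0} \<in> K" using assms(1,2) by (auto simp: simplicial_def)
  moreover have "sum t {v. t v \<noteq> 0} = sum t \<sigma>"
    using assms(1,2) sub by (intro sum.mono_neutral_left) (auto simp: simplicial_def)
  ultimately show ?thesis using assms by (simp add: geom_def)
qed

lemma geom_nonneg: "t \<in> geom K \<Longrightarrow> 0 \<le> t v"
  by (simp add: geom_def)

lemma geom_support: "t \<in> geom K \<Longrightarrow> {v. t v \<noteq> 0} \<in> K"
  by (simp add: geom_def)

lemma geom_sum:
  assumes "t \<in> geom K" "finite \<sigma>" "\<And>v. v \<notin> \<sigma> \<Longrightarrow> t v = 0"
  shows "sum t \<sigma> = 1"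
proof -
  have "sum t {v. t v \<noteq> 0} = sum t \<sigma>"
    using assms(2,3) by (intro sum.mono_neutral_left) auto
  then show ?thesis using assms(1) by (simp add: geom_def)
qed

lemma geom_le_1:
  assumes K: "simplicial K" and t: "t \<in> geom K" shows "t v \<le> 1"
proof (cases "t v = 0")
  case False
  have "t v \<le> sum t {v. t v \<noteq> 0}"
    using False K t by (intro member_le_sum) (auto simp: geom_def simplicial_def)
  then show ?thesis using t by (simp add: geom_def)
qed simp

lemma geom_vertex:
  assumes "simplicial K" "{v} \<in> K" shows "(\<lambda>w. if w = v then 1 else 0) \<in> geom K"
  using assms by (intro geomI[of K "{v}"]) auto

lemma geom_mono: "K \<subseteq> L \<Longrightarrow> geom K \<subseteq> geom L"
  by (auto simp: geom_def)

lemma geom_convex_combination: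
  assumes K: "simplicial K" "\<sigma> \<in> K" and s: "s \<in> geom K" "\<And>w. w \<notin> \<sigma> \<Longrightarrow> s w = 0"
    and t: "t \<in> geom K" "\<And>w. w \<notin> \<sigma> \<Longrightarrow> t w = 0" and a: "0 \<le> a" "a \<le> 1"
  shows "(\<lambda>w. (1 - a) * s w + a * t w) \<in> geom K"
proof (rule geomI[OF K])
  have fin: "finite \<sigma>" using K by (auto simp: simplicial_def)
  have "(\<Sum>w\<in>\<sigma>. (1 - a) * s w + a * t w) = (1 - a) * sum s \<sigma> + a * sum t \<sigma>"
    by (simp add: sum.distrib sum_distrib_left)
  also have "\<dots> = 1" using geom_sum[OF s(1) fin s(2)] geom_sum[OF t(1) fin t(2)] by simp
  finally show "(\<Sum>w\<in>\<sigma>. (1 - a) * s w + a * t w) = 1" .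
  show "0 \<le> (1 - a) * s v + a * t v" for v
    using a geom_nonneg[OF s(1)] geom_nonneg[OF t(1)] by simp
qed (use s t in auto)

text \<open>If the two values at each point share a face, the segment between them stays in that
  face. The later deformations of complexes are built from such segments.\<close>

lemma homotopic_straight_line:
  fixes f g :: "'b::topological_space \<Rightarrow> 'a \<Rightarrow> real"
  assumes K: "simplicial K"
    and f: "continuous_on T f" "f \<in> T \<rightarrow> geom K"
    and g: "continuous_on T g" "g \<in> T \<rightarrow> geom K"
    and face: "\<And>y. y \<in> T \<Longrightarrow> \<exists>\<sigma>\<in>K. \<forall>w. w \<notin> \<sigma> \<longrightarrow> f y w = 0 \<and> g y w = 0"
  shows "homotopic_with_canon (\<lambda>_. True) T (geom K) f g"
proof -
  define H where "H = (\<lambda>(s::real, y) w. (1 - s) * f y w + s * g y w)"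
  have coord: "continuous_on ({0..1} \<times> T) (\<lambda>p. h (snd p) w)"
    if "continuous_on T h" for h :: "'b \<Rightarrow> 'a \<Rightarrow> real" and w
  proof -
    have "continuous_on T (\<lambda>y. h y w)"
      using that by (rule continuous_on_product_then_coordinatewise)
    then show ?thesis
      by (rule continuous_on_compose2[where f = snd]) (auto intro: continuous_on_snd continuous_on_id)
  qed
  have "continuous_on ({0..1} \<times> T) H"
    unfolding H_def case_prod_unfold
    by (intro continuous_on_coordinatewise_then_product continuous_on_add continuous_on_mult
        continuous_on_diff continuous_on_const continuous_on_fst continuous_on_id coord f g)
  moreover have "H \<in> {0..1} \<times> T \<rightarrow> geom K"
  proof
    fix p assume "p \<in> {0..1::real} \<times> T"
    then obtain s y where p: "p = (s, y)" and s: "0 \<le> s" "s \<le> 1" and y: "y \<in> T" by auto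
    obtain \<sigma> where \<sigma>: "\<sigma> \<in> K" "\<And>w. w \<notin> \<sigma> \<Longrightarrow> f y w = 0 \<and> g y w = 0" using face[OF y] by blast
    have "f y \<in> geom K" "g y \<in> geom K" using f(2) g(2) y by auto
    then show "H p \<in> geom K"
      unfolding p H_def using \<sigma> s by (auto intro!: geom_convex_combination[OF K \<sigma>(1)])
  qed
  ultimately show ?thesis
    unfolding homotopic_with_def by (intro exI[of _ H]) (auto simp: H_def)
qed

text \<open>The distance of two sequences is at most twice the largest of finitely many coordinate
  distances plus a geometric tail. This ties the mesh of a grid to uniform continuity in the
  metric.\<close>

lemma dist_fun_less_if_coordinates_close:
  fixes \<delta> :: real
  assumes "\<delta> > 0"
  shows "\<exists>\<epsilon>>0. \<forall>x y :: nat \<Rightarrow> real. (\<forall>k. \<bar>x k - y k\<bar> \<le> \<epsilon>) \<longrightarrow> dist x y < \<delta>"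
proof -
  obtain M where M: "(1/2::real) ^ M < \<delta> / 2"
    using real_arch_pow_inv[of "\<delta>/2" "1/2"] assms by auto
  have "dist x y < \<delta>" if *: "\<forall>k. \<bar>x k - y k\<bar> \<le> \<delta> / 4" for x y :: "nat \<Rightarrow> real"
  proof -
    have "Max {dist (x (from_nat n)) (y (from_nat n)) |n. n \<le> M} \<le> \<delta> / 4"
      using * by (intro Max.boundedI) (auto simp: dist_real_def)
    then show ?thesis using dist_fun_le_dist_first_terms[of x y M] M by linarith
  qed
  then show ?thesis using assms by (intro exI[of _ "\<delta> / 4"]) auto
qed

lemma simplicial_link: "simplicial K \<Longrightarrow> simplicial (link K F)"
  unfolding simplicial_def link_def
  by (auto; metis Un_mono order_refl)

lemma simplicial_deletion: "simplicial K \<Longrightarrow> simplicial {\<sigma> \<in> K. v \<notin> \<sigma>}"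
  unfolding simplicial_def by blast

text \<open>Radial projection away from \<open>v\<close>: its weight is dropped and the rest
  rescaled to sum 1. The new support is the old one without \<open>v\<close>, and a face of the link
  if \<open>v\<close> was in the support.\<close>

lemma project_from_vertex:
  assumes K: "simplicial K" and t: "t \<in> geom K" "t v < 1"
  shows "(\<lambda>w. if w = v then 0 else t w / (1 - t v)) \<in> geom {\<sigma> \<in> K. v \<notin> \<sigma>}"
    and "t v > 0 \<Longrightarrow> (\<lambda>w. if w = v then 0 else t w / (1 - t v)) \<in> geom (link K {v})"
proof -
  let ?r = "\<lambda>w. if w = v then 0 else t w / (1 - t v)"
  let ?\<sigma> = "{w. t w \<noteq> 0}"
  have \<sigma>: "?\<sigma> \<in> K" "finite ?\<sigma>" using t K by (auto simp: geom_def simplicial_def)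
  have face: "?\<sigma> - {v} \<in> K" using \<sigma> K by (auto simp: simplicial_def)
  have "sum t ?\<sigma> = 1" using t by (simp add: geom_def)
  then have "sum t (?\<sigma> - {v}) = 1 - t v" using \<sigma> by (auto simp: sum_diff1)
  then have "sum (\<lambda>w. t w / (1 - t v)) (?\<sigma> - {v}) = 1"
    using t(2) by (simp flip: sum_divide_distrib)
  then have sum: "sum ?r (?\<sigma> - {v}) = 1" by (subst sum.cong[OF refl, of _ _ "\<lambda>w. t w / (1 - t v)"]) auto
  have nonneg: "0 \<le> ?r w" for w using t geom_nonneg[OF t(1)] by simp
  show "?r \<in> geom {\<sigma> \<in> K. v \<notin> \<sigma>}"
    by (rule geomI[OF simplicial_deletion[OF K], of "?\<sigma> - {v}"]) (use face nonneg sum in auto)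
  show "?r \<in> geom (link K {v})" if "t v > 0"
  proof (rule geomI[OF simplicial_link[OF K], of "?\<sigma> - {v}"])
    have "{v} \<union> (?\<sigma> - {v}) = ?\<sigma>" using that by auto
    then show "?\<sigma> - {v} \<in> link K {v}" using face \<sigma> by (simp add: link_def)
  qed (use nonneg sum in auto)
qed

text \<open>\<open>K\<close> is the deletion of \<open>v\<close> with a cone over the link attached.
  An \<open>i\<close>-sphere with \<open>i \<le> d\<close> is pushed off \<open>v\<close> on cells
  of dimension at most \<open>i\<close>, for which \<open>(d - 1)\<close>-connectedness of the link
  is enough; the rest happens in the contractible deletion.\<close>

lemma k_connected_cone_attachment:
  assumes K: "simplicial K" and v: "{v} \<in> K"
    and contr: "contractible (geom {\<sigma> \<in> K. v \<notin> \<sigma>})"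
    and link: "k_connected (d - 1) (top_of_set (geom (link K {v})))"
  shows "k_connected d (top_of_set (geom K))"
  unfolding k_connected_top_of_set
proof (intro conjI impI allI)
  show "geom K \<noteq> {}" using geom_vertex[OF K v] by blast
next
  fix i and f :: "(nat \<Rightarrow> real) \<Rightarrow> 'a \<Rightarrow> real"
  assume i: "int i \<le> d" and f: "continuous_on (euclid_sphere i) f" "f \<in> euclid_sphere i \<rightarrow> geom K"
  let ?K' = "{\<sigma> \<in> K. v \<notin> \<sigma>}"
  \<comment> \<open>\<phi> is constant along rays, hence usable on cube boundaries of all sizes;
    \<open>u\<close> is the weight it gives to the apex \<open>v\<close>.\<close>
  define \<phi> where "\<phi> = (\<lambda>y. f (to_sphere i y))"
  define u where "u = (\<lambda>y. \<phi> y v)"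
  have sph: "to_sphere i y \<in> euclid_sphere i" if "y \<in> cube_frontier (Suc i) r" "r > 0" for y r
    using that by (intro to_sphere_in) (auto simp: cube_frontier_def)
  have cont_\<phi>: "continuous_on (cube_frontier (Suc i) r) \<phi>" if "r > 0" for r
    unfolding \<phi>_def
  proof (rule continuous_on_compose2[OF f(1)])
    show "continuous_on (cube_frontier (Suc i) r) (to_sphere i)"
      using that by (intro continuous_on_subset[OF continuous_on_to_sphere]) (auto simp: cube_frontier_def)
  qed (use sph that in blast)
  have cont_u: "continuous_on (cube_frontier (Suc i) r) u" if "r > 0" for r
    unfolding u_def using cont_\<phi>[OF that] by (rule continuous_on_product_then_coordinatewise)
  \<comment> \<open>Uniform continuity is taken at radius 1 and the grid at radius \<open>N\<close>:
    scaled by \<open>1 / N\<close>, the unit cells have side less than \<epsilon>.\<close>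
  have "uniformly_continuous_on (cube_frontier (Suc i) 1) u"
    by (intro compact_uniformly_continuous cont_u compact_cube_frontier) simp
  then obtain \<delta> where \<delta>: "\<delta> > 0" "\<And>y y'. y \<in> cube_frontier (Suc i) 1 \<Longrightarrow>
      y' \<in> cube_frontier (Suc i) 1 \<Longrightarrow> dist y' y < \<delta> \<Longrightarrow> dist (u y') (u y) < 1/3"
    unfolding uniformly_continuous_on_def by (metis zero_less_divide_1_iff zero_less_numeral)
  obtain \<epsilon> where \<epsilon>: "\<epsilon> > 0" "\<And>x y :: nat \<Rightarrow> real. (\<And>k. \<bar>x k - y k\<bar> \<le> \<epsilon>) \<Longrightarrow> dist x y < \<delta>"
    using dist_fun_less_if_coordinates_close[OF \<delta>(1)] by blast
  obtain N :: nat where N: "N > 0" "1 / real N < \<epsilon>"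
    using \<epsilon>(1) ex_inverse_of_nat_less[of \<epsilon>] by (auto simp: inverse_eq_divide)
  let ?B = "cube_frontier (Suc i) (real N)"
  have N0: "real N > 0" using N by simp
  obtain F where F: "finite F" "face_closed F" "\<And>c J. (c, J) \<in> F \<Longrightarrow> finite J \<and> card J \<le> i"
    and FB: "cells_union F = ?B"
    using cube_frontier_grid[of i N] by fast
  have cellB: "cell c J \<subseteq> ?B" if "(c, J) \<in> F" for c J
    using that FB by (auto simp: cells_union_def)
  have \<phi>_geom: "\<phi> y \<in> geom K" if "y \<in> ?B" for y
    unfolding \<phi>_def using sph[OF that N0] f(2) by auto
  have u01: "0 \<le> u y" "u y \<le> 1" if "y \<in> ?B" for y
    unfolding u_def using geom_nonneg[OF \<phi>_geom[OF that]] geom_le_1[OF K \<phi>_geom[OF that]] by auto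
  have osc: "\<bar>u y - u y'\<bar> < 1/3" if "(c, J) \<in> F" "y \<in> cell c J" "y' \<in> cell c J" for c J y y'
  proof -
    have yB: "y \<in> ?B" "y' \<in> ?B" using that cellB by blast+
    have scale: "(\<lambda>k. (1 / real N) * z k) \<in> cube_frontier (Suc i) 1" "u (\<lambda>k. (1 / real N) * z k) = u z"
      if "z \<in> ?B" for z
    proof -
      have "sup_norm (Suc i) (\<lambda>k. (1 / real N) * z k) = (1 / real N) * sup_norm (Suc i) z"
        by (rule sup_norm_scale) simp
      then show "(\<lambda>k. (1 / real N) * z k) \<in> cube_frontier (Suc i) 1"
        using that N0 by (simp add: cube_frontier_def)
      show "u (\<lambda>k. (1 / real N) * z k) = u z"
        unfolding u_def \<phi>_def using N0 by (subst to_sphere_scale) auto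
    qed
    have "\<bar>(1 / real N) * y k - (1 / real N) * y' k\<bar> \<le> \<epsilon>" for k
    proof -
      have "\<bar>y k - y' k\<bar> \<le> 1"
        using cellD[OF that(2), of k] cellD[OF that(3), of k] by (auto split: if_splits)
      then have "(1 / real N) * \<bar>y k - y' k\<bar> \<le> 1 / real N"
        using N0 by (simp add: divide_right_mono)
      moreover have "\<bar>(1 / real N) * y k - (1 / real N) * y' k\<bar> = (1 / real N) * \<bar>y k - y' k\<bar>"
        using N0 by (simp add: abs_mult flip: right_diff_distrib diff_divide_distrib)
      ultimately show ?thesis using N(2) by linarith
    qed
    then have "dist (u (\<lambda>k. (1 / real N) * y k)) (u (\<lambda>k. (1 / real N) * y' k)) < 1/3"
      by (intro \<delta>(2) scale yB \<epsilon>(2))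
    then show ?thesis using scale(2) yB by (simp add: dist_real_def)
  qed
  \<comment> \<open>On \<open>F1\<close> the weight of \<open>v\<close> stays away from 1, so
    projection from \<open>v\<close> makes sense; on \<open>F2\<close> it is positive, so the points
    lie in the open star of \<open>v\<close>. The gap between the thresholds is the oscillation
    bound 1/3, so every cell belongs to one of the families.\<close>
  define F1 where "F1 = {(c, J) \<in> F. \<forall>y\<in>cell c J. u y \<le> 2/3}"
  define F2 where "F2 = {(c, J) \<in> F. \<forall>y\<in>cell c J. 1/3 \<le> u y}"
  have F12: "F = F1 \<union> F2"
  proof (intro equalityI subsetI)
    fix D assume D: "D \<in> F"
    obtain c J where cJ: "D = (c, J)" by (cases D)
    show "D \<in> F1 \<union> F2"
    proof (rule ccontr)
      assume "D \<notin> F1 \<union> F2"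
      then obtain y y' where "y \<in> cell c J" "2/3 < u y" "y' \<in> cell c J" "u y' < 1/3"
        using D by (auto simp: F1_def F2_def cJ not_le)
      then show False using osc[of c J y y'] D cJ by auto
    qed
  qed (auto simp: F1_def F2_def)
  have fc: "face_closed F1" "face_closed F2" "face_closed (F1 \<inter> F2)"
    unfolding F1_def F2_def by (intro face_closed_Int face_closed_restrict F(2))+
  have fin: "finite F1" "finite F2" using F(1) F12 by auto
  define \<rho> where "\<rho> = (\<lambda>(t::'a \<Rightarrow> real) w. if w = v then 0 else t w / (1 - t v))"
  have B1: "y \<in> ?B" "u y \<le> 2/3" if "y \<in> cells_union F1" for y
    using that cellB by (auto simp: cells_union_def F1_def)
  have B2: "y \<in> ?B" "1/3 \<le> u y" if "y \<in> cells_union F2" for y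
    using that cellB by (auto simp: cells_union_def F2_def)
  have cont_\<rho>: "continuous_on (cells_union F1) (\<lambda>y. \<rho> (\<phi> y))"
    unfolding \<rho>_def
  proof (rule continuous_on_coordinatewise_then_product)
    fix w
    have "continuous_on (cells_union F1) \<phi>"
      using B1 by (intro continuous_on_subset[OF cont_\<phi>[OF N0]]) blast
    then have "continuous_on (cells_union F1) (\<lambda>y. \<phi> y w)" "continuous_on (cells_union F1) (\<lambda>y. \<phi> y v)"
      by (auto intro: continuous_on_product_then_coordinatewise)
    then have "continuous_on (cells_union F1) (\<lambda>y. \<phi> y w / (1 - \<phi> y v))"
      using B1(2) by (intro continuous_intros) (force simp: u_def)+
    then show "continuous_on (cells_union F1) (\<lambda>y. if w = v then 0 else \<phi> y w / (1 - \<phi> y v))"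
      by (cases "w = v") auto
  qed
  have \<rho>K': "\<rho> (\<phi> y) \<in> geom ?K'" if "y \<in> cells_union F1" for y
    unfolding \<rho>_def using project_from_vertex(1)[OF K \<phi>_geom[OF B1(1)[OF that]]] B1(2)[OF that]
    by (auto simp: u_def)
  have \<rho>link: "\<rho> (\<phi> y) \<in> geom (link K {v})" if "y \<in> cells_union (F1 \<inter> F2)" for y
  proof -
    have y: "y \<in> cells_union F1" "y \<in> cells_union F2" using that by (auto simp: cells_union_def)
    show ?thesis
      unfolding \<rho>_def using project_from_vertex(2)[OF K \<phi>_geom[OF B1(1)[OF y(1)]]] B1(2)[OF y(1)] B2(2)[OF y(2)]
      by (auto simp: u_def)
  qed
  \<comment> \<open>On \<open>F2\<close> the projection breaks down where \<open>u\<close> reaches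
    1. It is kept on the overlap with \<open>F1\<close> and replaced elsewhere by an extension with
    values in the link.\<close>
  have "\<exists>h. continuous_on (cells_union F2) h \<and> h \<in> cells_union F2 \<rightarrow> geom (link K {v}) \<and>
      (\<forall>y\<in>cells_union (F1 \<inter> F2). h y = \<rho> (\<phi> y))"
  proof (rule cells_union_extension[OF link fin(2) fc(2) _ _ fc(3)])
    show "finite J \<and> int (card J) \<le> d - 1 + 1" if "(c, J) \<in> F2" for c J
      using F(3)[of c J] that i F12 by fastforce
    show "continuous_on (cells_union (F1 \<inter> F2)) (\<lambda>y. \<rho> (\<phi> y))"
      by (rule continuous_on_subset[OF cont_\<rho>]) (auto simp: cells_union_def)
    show "(\<lambda>y. \<rho> (\<phi> y)) \<in> cells_union (F1 \<inter> F2) \<rightarrow> geom (link K {v})" using \<rho>link by blast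
  qed blast
  then obtain h where h: "continuous_on (cells_union F2) h" "h \<in> cells_union F2 \<rightarrow> geom (link K {v})"
    and h\<rho>: "\<And>y. y \<in> cells_union (F1 \<inter> F2) \<Longrightarrow> h y = \<rho> (\<phi> y)" by blast
  define G where "G = (\<lambda>y. if y \<in> cells_union F1 then \<rho> (\<phi> y) else h y)"
  have un: "cells_union F1 \<union> cells_union F2 = ?B"
    unfolding FB[symmetric] F12 by (auto simp: cells_union_def)
  have cont_G: "continuous_on ?B G"
    unfolding un[symmetric] G_def
    by (rule continuous_on_cases[OF closed_cells_union closed_cells_union cont_\<rho> h(1)])
      (use fin h\<rho> cells_union_Int[OF fc(1,2)] in auto)
  have G2: "G y \<in> geom (link K {v})" if "y \<in> cells_union F2" for y
    unfolding G_def using that h(2) \<rho>link cells_union_Int[OF fc(1,2)] by auto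
  have link_sub: "link K {v} \<subseteq> ?K'" by (auto simp: link_def)
  have GK': "G y \<in> geom ?K'" if "y \<in> ?B" for y
  proof (cases "y \<in> cells_union F1")
    case True
    then show ?thesis using \<rho>K' by (simp add: G_def)
  next
    case False
    then have "y \<in> cells_union F2" using that un by blast
    then show ?thesis using G2 geom_mono[OF link_sub] by blast
  qed
  have GK: "G y \<in> geom K" if "y \<in> ?B" for y
    using GK'[OF that] geom_mono[of ?K' K] by auto
  have Gv: "G y v = 0" if "y \<in> ?B" for y
    using geom_support[OF GK'[OF that]] by auto
  \<comment> \<open>\<open>\<Phi>\<close> is the vertex \<open>v\<close> wherever \<open>u \<ge> 1/3\<close>, in particular wherever \<open>G\<close> is not the projection of
    \<open>\<phi>\<close>; so both \<open>\<phi>\<close> and \<open>G\<close> share a face with it pointwise.\<close>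
  define \<Phi> where "\<Phi> = (\<lambda>y w. (1 - min 1 (3 * u y)) * G y w + min 1 (3 * u y) * (if w = v then 1 else 0))"
  \<comment> \<open>Where \<open>v\<close> has positive weight, \<open>v\<close> and the support of
    \<open>G\<close> span a face: on \<open>F1\<close> inside the support of \<phi>, elsewhere
    because \<open>G\<close> lies in the link.\<close>
  have cone_face: "insert v {w. G y w \<noteq> 0} \<in> K" if y: "y \<in> ?B" "u y > 0" for y
  proof (cases "y \<in> cells_union F1")
    case True
    then have "insert v {w. G y w \<noteq> 0} \<subseteq> {w. \<phi> y w \<noteq> 0}"
      using y(2) by (auto simp: G_def \<rho>_def u_def)
    then show ?thesis using geom_support[OF \<phi>_geom[OF y(1)]] K by (auto simp: simplicial_def)
  next
    case False
    then have "y \<in> cells_union F2" using y un by blast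
    from geom_support[OF G2[OF this]] show ?thesis by (simp add: link_def)
  qed
  have support_G: "\<phi> y w = 0 \<Longrightarrow> G y w = 0" if "y \<in> cells_union F1" for y w
    using that by (simp add: G_def \<rho>_def)
  have \<Phi>G_face: "\<exists>\<sigma>\<in>K. \<forall>w. w \<notin> \<sigma> \<longrightarrow> \<Phi> y w = 0 \<and> G y w = 0" if y: "y \<in> ?B" for y
  proof (cases "u y > 0")
    case True
    then show ?thesis using cone_face[OF y] by (intro bexI[of _ "insert v {w. G y w \<noteq> 0}"]) (auto simp: \<Phi>_def)
  next
    case False
    then have "u y = 0" using u01[OF y] by simp
    then show ?thesis using geom_support[OF GK[OF y]]
      by (intro bexI[of _ "{w. G y w \<noteq> 0}"]) (auto simp: \<Phi>_def)
  qed
  have \<Phi>K: "\<Phi> y \<in> geom K" if y: "y \<in> ?B" for y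
  proof (cases "u y > 0")
    case True
    show ?thesis
      unfolding \<Phi>_def
      by (rule geom_convex_combination[OF K cone_face[OF y True] GK[OF y] _ geom_vertex[OF K v]])
        (use u01[OF y] in auto)
  next
    case False
    then have "u y = 0" using u01[OF y] by simp
    then have "\<Phi> y = G y" by (auto simp: \<Phi>_def)
    then show ?thesis using GK[OF y] by simp
  qed
  have cont_\<Phi>: "continuous_on ?B \<Phi>"
    unfolding \<Phi>_def
    by (intro continuous_on_coordinatewise_then_product continuous_on_add continuous_on_mult
        continuous_on_diff continuous_on_min continuous_on_const cont_u N0
        continuous_on_product_then_coordinatewise[OF cont_G])
  have \<phi>\<Phi>: "homotopic_with_canon (\<lambda>_. True) ?B (geom K) \<phi> \<Phi>"
  proof (rule homotopic_straight_line[OF K cont_\<phi>[OF N0] _ cont_\<Phi>])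
    fix y assume y: "y \<in> ?B"
    have "\<Phi> y w = 0" if w: "\<phi> y w = 0" for w
    proof (cases "y \<in> cells_union F1")
      case True
      then show ?thesis using support_G[OF True w] w by (auto simp: \<Phi>_def u_def)
    next
      case False
      then have "1/3 \<le> u y" using y un B2 by blast
      then show ?thesis using w by (auto simp: \<Phi>_def u_def min_def)
    qed
    then show "\<exists>\<sigma>\<in>K. \<forall>w. w \<notin> \<sigma> \<longrightarrow> \<phi> y w = 0 \<and> \<Phi> y w = 0"
      using geom_support[OF \<phi>_geom[OF y]] by (intro bexI[of _ "{w. \<phi> y w \<noteq> 0}"]) auto
  qed (use \<phi>_geom \<Phi>K in auto)
  have "homotopic_with_canon (\<lambda>_. True) ?B (geom K) \<Phi> G"
    by (rule homotopic_straight_line[OF K cont_\<Phi> _ cont_G]) (use \<Phi>K GK \<Phi>G_face in auto)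
  with \<phi>\<Phi> have \<phi>G: "homotopic_with_canon (\<lambda>_. True) ?B (geom K) \<phi> G"
    by (rule homotopic_with_trans)
  \<comment> \<open>\<open>G\<close> has values in the contractible deletion, so it is
    null-homotopic there and hence in \<open>K\<close>. Composition with \<open>to_cube\<close>
    carries this back to \<open>f\<close>.\<close>
  obtain a where "homotopic_with_canon (\<lambda>x. True) (geom ?K') (geom ?K') id (\<lambda>x. a)"
    using contr by (auto simp: contractible_def)
  then have "homotopic_with_canon (\<lambda>x. True) ?B (geom ?K') (id \<circ> G) ((\<lambda>x. a) \<circ> G)"
    by (rule homotopic_with_compose_continuous_map_right) (use cont_G GK' in auto)
  then have "homotopic_with_canon (\<lambda>x. True) ?B (geom K) G (\<lambda>x. a)"
    using homotopic_with_subset_right[of "\<lambda>x. True" ?B "geom ?K'" G] geom_mono[of ?K' K]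
    by (auto simp: o_def)
  with \<phi>G have "homotopic_with_canon (\<lambda>x. True) ?B (geom K) \<phi> (\<lambda>x. a)"
    by (rule homotopic_with_trans)
  then have "homotopic_with_canon (\<lambda>x. True) (euclid_sphere i) (geom K)
      (\<phi> \<circ> to_cube i (real N)) ((\<lambda>x. a) \<circ> to_cube i (real N))"
    by (rule homotopic_with_compose_continuous_map_right)
      (use continuous_on_to_cube to_cube_in[OF _ N0] in auto)
  then have "homotopic_with_canon (\<lambda>x. True) (euclid_sphere i) (geom K) f (\<lambda>x. a)"
    by (rule homotopic_with_eq) (auto simp: \<phi>_def to_sphere_to_cube[OF _ N0])
  then show "\<exists>c. homotopic_with_canon (\<lambda>_. True) (euclid_sphere i) (geom K) f (\<lambda>_. c)" by blast
qed

section \<open>Order complexes\<close>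

lemma chain_iff: "pred_on.chain A (\<le>) C \<longleftrightarrow> C \<subseteq> A \<and> (\<forall>y\<in>C. \<forall>z\<in>C. y \<le> z \<or> z \<le> (y::'a::order))"
  by (auto simp: pred_on.chain_def)

lemma order_complex_iff:
  "C \<in> order_complex A \<longleftrightarrow> finite C \<and> C \<subseteq> A \<and> (\<forall>y\<in>C. \<forall>z\<in>C. y \<le> z \<or> z \<le> (y::'a::order))"
  by (simp add: order_complex_def chain_iff)

lemma simplicial_order_complex: "simplicial (order_complex A)"
  unfolding simplicial_def
proof (intro ballI conjI allI impI)
  fix \<sigma> \<tau> assume "\<sigma> \<in> order_complex A" "\<tau> \<subseteq> \<sigma>"
  then show "\<tau> \<in> order_complex A"
    using finite_subset[of \<tau> \<sigma>] unfolding order_complex_iff by blast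
qed (simp add: order_complex_iff)

definition link_poset :: "'a::order set \<Rightarrow> 'a set \<Rightarrow> 'a set" where
  "link_poset A F = {z \<in> A - F. \<forall>a\<in>F. z \<le> a \<or> a \<le> z}"

lemma link_order_complex:
  assumes "F \<in> order_complex A"
  shows "link (order_complex A) F = order_complex (link_poset A F)"
  using assms unfolding link_def link_poset_def
  by (auto simp: order_complex_iff) blast+

lemma deletion_order_complex:
  "{\<sigma> \<in> order_complex A. v \<notin> \<sigma>} = order_complex (A - {v})"
  by (intro set_eqI) (simp add: order_complex_iff, blast)

lemma finite_order_complex: "finite A \<Longrightarrow> finite (order_complex A)"
  by (rule finite_subset[of _ "Pow A"]) (auto simp: order_complex_iff)

lemma complex_dim_order_complex_ge:
  "finite A \<Longrightarrow> C \<in> order_complex A \<Longrightarrow> int (card C) - 1 \<le> complex_dim (order_complex A)"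
  unfolding complex_dim_def
  using Max_ge[OF finite_imageI[OF finite_order_complex], of A "card C" card] by simp

lemma complex_dim_order_complex_le:
  assumes "finite A" "\<And>C. C \<in> order_complex A \<Longrightarrow> int (card C) \<le> k + 1"
  shows "complex_dim (order_complex A) \<le> k"
proof -
  have "{} \<in> order_complex A" by (simp add: order_complex_iff)
  then have "Max (card ` order_complex A) \<in> card ` order_complex A"
    using finite_order_complex[OF assms(1)] by (intro Max_in) auto
  then obtain C where "C \<in> order_complex A" "Max (card ` order_complex A) = card C" by auto
  then show ?thesis using assms(2)[of C] unfolding complex_dim_def by simp
qed

lemma k_connected_mono: "k_connected k X \<Longrightarrow> j \<le> k \<Longrightarrow> k_connected j X"
  unfolding k_connected_def by auto

lemma contractible_imp_k_connected:
  fixes S :: "'b::topological_space set"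
  assumes "contractible S" "S \<noteq> {}" shows "k_connected k (top_of_set S)"
  unfolding k_connected_top_of_set
proof (intro conjI impI allI)
  fix i and f :: "(nat \<Rightarrow> real) \<Rightarrow> 'b"
  assume f: "continuous_on (euclid_sphere i) f" "f \<in> euclid_sphere i \<rightarrow> S"
  obtain a where "homotopic_with_canon (\<lambda>_. True) S S id (\<lambda>_. a)"
    using assms(1) by (auto simp: contractible_def)
  then have "homotopic_with_canon (\<lambda>_. True) (euclid_sphere i) S (id \<circ> f) ((\<lambda>_. a) \<circ> f)"
    by (rule homotopic_with_compose_continuous_map_right) (use f in auto)
  then show "\<exists>c. homotopic_with_canon (\<lambda>_. True) (euclid_sphere i) S f (\<lambda>_. c)"
    by (auto simp: o_def)
qed (use assms in auto)

text \<open>A null-homotopy of \<open>b \<circ> f\<close> in \<open>S\<close> is carried by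
  \<open>a\<close> to one of \<open>a \<circ> (b \<circ> f)\<close>, which agrees with
  \<open>f\<close>.\<close>

lemma k_connected_retract:
  fixes S :: "'b::topological_space set" and T :: "'c::topological_space set"
  assumes S: "k_connected k (top_of_set S)"
    and a: "continuous_on S a" "a \<in> S \<rightarrow> T" and b: "continuous_on T b" "b \<in> T \<rightarrow> S"
    and ab: "\<And>y. y \<in> T \<Longrightarrow> a (b y) = y"
  shows "k_connected k (top_of_set T)"
  unfolding k_connected_top_of_set
proof (intro conjI impI allI)
  show "T \<noteq> {}" if "-1 \<le> k" using that S a by (auto simp: k_connected_top_of_set)
next
  fix i and f :: "(nat \<Rightarrow> real) \<Rightarrow> 'c"
  assume i: "int i \<le> k" and f: "continuous_on (euclid_sphere i) f" "f \<in> euclid_sphere i \<rightarrow> T"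
  have "continuous_on (euclid_sphere i) (b \<circ> f)"
    using f b by (intro continuous_on_compose) (auto elim: continuous_on_subset)
  moreover have "b \<circ> f \<in> euclid_sphere i \<rightarrow> S" using f b by auto
  ultimately obtain c where "homotopic_with_canon (\<lambda>_. True) (euclid_sphere i) S (b \<circ> f) (\<lambda>_. c)"
    using S i unfolding k_connected_top_of_set by blast
  then have "homotopic_with_canon (\<lambda>_. True) (euclid_sphere i) T (a \<circ> (b \<circ> f)) (a \<circ> (\<lambda>_. c))"
    by (rule homotopic_with_compose_continuous_map_left) (use a in auto)
  then have "homotopic_with_canon (\<lambda>_. True) (euclid_sphere i) T f (\<lambda>_. a c)"
    by (rule homotopic_with_eq) (use ab funcset_mem[OF f(2)] in auto)
  then show "\<exists>c. homotopic_with_canon (\<lambda>_. True) (euclid_sphere i) T f (\<lambda>_. c)" by blast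
qed

text \<open>Every chain stays a chain when \<open>c\<close> is added, so straight segments lead from
  all points to the vertex \<open>c\<close>.\<close>

lemma contractible_order_complex_cone:
  assumes c: "c \<in> A" and cmp: "\<And>z. z \<in> A \<Longrightarrow> z \<le> c \<or> c \<le> z"
  shows "contractible (geom (order_complex A))"
  unfolding contractible_def
proof (rule exI, rule homotopic_straight_line[OF simplicial_order_complex])
  have "{c} \<in> order_complex A" using c by (simp add: order_complex_iff)
  then show "(\<lambda>_. (\<lambda>w. if w = c then 1 else 0)) \<in> geom (order_complex A) \<rightarrow> geom (order_complex A)"
    using geom_vertex[OF simplicial_order_complex] by blast
  fix t assume t: "t \<in> geom (order_complex A)"
  have "insert c {w. t w \<noteq> 0} \<in> order_complex A"
    using geom_support[OF t] c cmp by (auto simp: order_complex_iff subset_iff)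
  then show "\<exists>\<sigma>\<in>order_complex A. \<forall>w. w \<notin> \<sigma> \<longrightarrow> id t w = 0 \<and> (if w = c then 1 else 0) = (0::real)"
    by (rule rev_bexI) auto
qed auto

text \<open>A chain through \<open>a\<close> stays a chain when \<open>b\<close> is added, so the
  weight of \<open>a\<close> can be shifted to \<open>b\<close>. This deforms the complex into that
  of \<open>A - {a}\<close>.\<close>

lemma contractible_order_complex_beat_point:
  fixes A :: "'a::order set"
  assumes ab: "a \<in> A" "b \<in> A" "a \<noteq> b"
    and cmp: "\<And>z. z \<in> A \<Longrightarrow> z \<le> a \<or> a \<le> z \<Longrightarrow> z \<le> b \<or> b \<le> z"
    and contr: "contractible (geom (order_complex (A - {a})))"
  shows "contractible (geom (order_complex A))"
proof -
  let ?K = "order_complex A" and ?K' = "order_complex (A - {a})"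
  define r where "r = (\<lambda>t::'a \<Rightarrow> real. \<lambda>w. if w = a then 0 else if w = b then t a + t b else t w)"
  have cont_r: "continuous_on T r" for T
    unfolding r_def
  proof (rule continuous_on_coordinatewise_then_product)
    fix w
    have *: "continuous_on T (\<lambda>t. t z)" for z :: 'a
      by (rule continuous_on_product_then_coordinatewise[OF continuous_on_id])
    show "continuous_on T (\<lambda>t. if w = a then 0 else if w = b then t a + t b else t w)"
      by (cases "w = a"; cases "w = b") (auto intro: * continuous_on_add)
  qed
  \<comment> \<open>Only when \<open>a\<close> carries weight is the whole support known to be
    comparable to \<open>b\<close>; hence the case distinction.\<close>
  have face: "(if t a = 0 then {w. t w \<noteq> 0} else insert b {w. t w \<noteq> 0}) \<in> ?K" if t: "t \<in> geom ?K" for t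
    using geom_support[OF t] ab cmp by (auto simp: order_complex_iff subset_iff)
  have r_geom: "r t \<in> geom ?K'" if t: "t \<in> geom ?K" for t
  proof -
    let ?\<sigma> = "if t a = 0 then {w. t w \<noteq> 0} else insert b {w. t w \<noteq> 0}"
    have \<sigma>: "finite ?\<sigma>" using face[OF t] by (simp only: order_complex_iff)
    have "?\<sigma> - {a} \<in> ?K'"
      using face[OF t] unfolding order_complex_iff by blast
    moreover have "sum (r t) (?\<sigma> - {a}) = 1"
    proof (cases "t a = 0")
      case True
      then have "r t = t" by (auto simp: r_def)
      then show ?thesis using True t by (simp add: geom_def)
    next
      case False
      let ?\<tau> = "insert b {w. t w \<noteq> 0}"
      have fin: "finite ?\<tau>" using \<sigma> False by simp
      have "sum t ?\<tau> = 1" by (rule geom_sum[OF t fin]) auto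
      moreover have "?\<tau> = insert a (insert b (?\<tau> - {a, b}))" using False by auto
      then have "sum t ?\<tau> = sum t (insert a (insert b (?\<tau> - {a, b})))" by simp
      then have "sum t ?\<tau> = t a + (t b + sum t (?\<tau> - {a, b}))"
        using fin ab(3) by simp
      moreover have "?\<tau> - {a} = insert b (?\<tau> - {a, b})" using ab(3) by auto
      then have "sum (r t) (?\<tau> - {a}) = sum (r t) (insert b (?\<tau> - {a, b}))" by simp
      then have "sum (r t) (?\<tau> - {a}) = r t b + sum (r t) (?\<tau> - {a, b})" using fin by simp
      moreover have "sum (r t) (?\<tau> - {a, b}) = sum t (?\<tau> - {a, b})"
        by (rule sum.cong) (auto simp: r_def)
      moreover have "r t b = t a + t b" using ab(3) by (simp add: r_def)
      ultimately show ?thesis using False by simp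
    qed
    moreover have "0 \<le> r t w" for w using geom_nonneg[OF t] by (simp add: r_def)
    moreover have "r t w = 0" if "w \<notin> ?\<sigma> - {a}" for w
      using that by (auto simp: r_def split: if_splits)
    ultimately show ?thesis by (intro geomI[OF simplicial_order_complex])
  qed
  have sub: "geom ?K' \<subseteq> geom ?K" by (rule geom_mono) (auto simp: order_complex_iff)
  have 1: "homotopic_with_canon (\<lambda>_. True) (geom ?K) (geom ?K) id r"
  proof (rule homotopic_straight_line[OF simplicial_order_complex])
    fix t assume t: "t \<in> geom ?K"
    show "\<exists>\<sigma>\<in>?K. \<forall>w. w \<notin> \<sigma> \<longrightarrow> id t w = 0 \<and> r t w = 0"
      using face[OF t] by (rule rev_bexI) (auto simp: r_def split: if_splits)
  qed (use cont_r r_geom sub in auto)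
  obtain c where "homotopic_with_canon (\<lambda>_. True) (geom ?K') (geom ?K') id (\<lambda>_. c)"
    using contr by (auto simp: contractible_def)
  then have "homotopic_with_canon (\<lambda>_. True) (geom ?K) (geom ?K') (id \<circ> r) ((\<lambda>_. c) \<circ> r)"
    by (rule homotopic_with_compose_continuous_map_right) (use cont_r r_geom in auto)
  then have "homotopic_with_canon (\<lambda>_. True) (geom ?K) (geom ?K) r (\<lambda>_. c)"
    using homotopic_with_subset_right[OF _ sub] by (auto simp: o_def)
  with 1 show ?thesis unfolding contractible_def using homotopic_with_trans by blast
qed

text \<open>
  The straight-line homotopy from the identity to \<open>f\<close> need not stay in the complex. Hence the points
  moved by \<open>f\<close> are removed one at a time, from the top: a maximal such point \<open>a\<close> is dominated by \<open>f a\<close>.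
\<close>

lemma contractible_order_complex_closure:
  fixes A :: "'a::order set"
  assumes "finite A" "c \<in> A" "f c = c" "f \<in> A \<rightarrow> A"
    and "\<And>y z. y \<in> A \<Longrightarrow> z \<in> A \<Longrightarrow> y \<le> z \<Longrightarrow> f y \<le> f z"
    and "\<And>z. z \<in> A \<Longrightarrow> z \<le> f z" "\<And>z. z \<in> A \<Longrightarrow> f (f z) = f z"
    and "\<And>z. z \<in> A \<Longrightarrow> c \<le> f z"
  shows "contractible (geom (order_complex A))"
  using assms
proof (induction "card A" arbitrary: A rule: less_induct)
  case (less A)
  show ?case
  proof (cases "\<forall>z\<in>A. f z = z")
    case True
    then have "c \<le> z" if "z \<in> A" for z using less.prems(8)[OF that] that by simp
    then show ?thesis using less.prems(2) by (intro contractible_order_complex_cone) auto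
  next
    case False
    let ?N = "{z \<in> A. f z \<noteq> z}"
    have "finite ?N" "?N \<noteq> {}" using False less.prems(1) by auto
    then obtain a where a: "a \<in> ?N" "\<And>z. z \<in> ?N \<Longrightarrow> a \<le> z \<Longrightarrow> a = z"
      using finite_has_maximal[of ?N] by blast
    have fixed: "f z = z" if "z \<in> A" "a \<le> z" "z \<noteq> a" for z using a(2)[of z] that by auto
    have ca: "c \<noteq> a" using a(1) less.prems(3) by auto
    \<comment> \<open>Values of \<open>f\<close> are fixed points while \<open>a\<close> is moved,
      so \<open>f\<close> restricts to \<open>A - {a}\<close>.\<close>
    have fa: "f z \<noteq> a" if "z \<in> A" for z using less.prems(7)[OF that] a(1) by auto
    have "contractible (geom (order_complex (A - {a})))"
    proof (rule less.hyps)
      show "card (A - {a}) < card A" using a(1) less.prems(1) by (intro card_Diff1_less) auto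
      show "f \<in> A - {a} \<rightarrow> A - {a}" using fa less.prems(4) by auto
      show "finite (A - {a})" using less.prems(1) by simp
      show "c \<in> A - {a}" using less.prems(2) ca by simp
    qed (simp_all add: less.prems)
    moreover have "z \<le> f a \<or> f a \<le> z" if z: "z \<in> A" "z \<le> a \<or> a \<le> z" for z
    proof (cases "z \<le> a")
      case True
      then show ?thesis using less.prems(6)[of a] a(1) by (auto intro: order_trans)
    next
      case False
      then have "a \<le> z" "f z = z" using z fixed by auto
      then show ?thesis using less.prems(5)[of a z] a(1) z(1) by auto
    qed
    ultimately show ?thesis
      using a(1) less.prems(4)
      by (intro contractible_order_complex_beat_point[of a A "f a"]) auto
  qed
qed

text \<open>Chains depend on comparability alone, so the condition on \<pi> is phrased in those
  terms. \<open>push\<close> and \<open>pull\<close> relabel barycentric coordinates along \<pi> and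
  its inverse.\<close>

lemma k_connected_order_complex_iso:
  fixes A :: "'a::order set" and B :: "'b::order set"
  assumes \<pi>: "bij_betw \<pi> A B"
    and iso: "\<And>y z. y \<in> A \<Longrightarrow> z \<in> A \<Longrightarrow> y \<le> z \<or> z \<le> y \<longleftrightarrow> \<pi> y \<le> \<pi> z \<or> \<pi> z \<le> \<pi> y"
    and B: "k_connected k (top_of_set (geom (order_complex B)))"
  shows "k_connected k (top_of_set (geom (order_complex A)))"
proof -
  define \<iota> where "\<iota> = inv_into A \<pi>"
  have \<iota>: "bij_betw \<iota> B A" using \<pi> by (simp add: \<iota>_def bij_betw_inv_into)
  have \<iota>\<pi>: "\<iota> (\<pi> w) = w" if "w \<in> A" for w using that \<pi> by (simp add: \<iota>_def bij_betw_inv_into_left)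
  have \<pi>\<iota>: "\<pi> (\<iota> z) = z" if "z \<in> B" for z using that \<pi> by (simp add: \<iota>_def bij_betw_inv_into_right)
  define pull :: "('b \<Rightarrow> real) \<Rightarrow> 'a \<Rightarrow> real" where "pull = (\<lambda>s w. if w \<in> A then s (\<pi> w) else 0)"
  define push :: "('a \<Rightarrow> real) \<Rightarrow> 'b \<Rightarrow> real" where "push = (\<lambda>t z. if z \<in> B then t (\<iota> z) else 0)"
  have "continuous_on T (\<lambda>s. if P then s z else (0::real))" for T P and z :: 'b
    by (cases P) (auto intro: continuous_on_product_then_coordinatewise[OF continuous_on_id])
  then have cont_pull: "continuous_on T pull" for T
    unfolding pull_def by (intro continuous_on_coordinatewise_then_product)
  have "continuous_on T (\<lambda>s. if P then s z else (0::real))" for T P and z :: 'a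
    by (cases P) (auto intro: continuous_on_product_then_coordinatewise[OF continuous_on_id])
  then have cont_push: "continuous_on T push" for T
    unfolding push_def by (intro continuous_on_coordinatewise_then_product)
  have pull: "pull s \<in> geom (order_complex A)" if s: "s \<in> geom (order_complex B)" for s
  proof -
    let ?\<sigma> = "{z. s z \<noteq> 0}"
    have \<sigma>: "?\<sigma> \<in> order_complex B" using s by (rule geom_support)
    then have sub: "?\<sigma> \<subseteq> B" by (simp add: order_complex_iff)
    show ?thesis
    proof (rule geomI[OF simplicial_order_complex, of "\<iota> ` ?\<sigma>"])
      have "\<iota> y \<le> \<iota> z \<or> \<iota> z \<le> \<iota> y" if "y \<in> ?\<sigma>" "z \<in> ?\<sigma>" for y z
      proof -
        have yz: "y \<in> B" "z \<in> B" "y \<le> z \<or> z \<le> y" using that \<sigma> sub by (auto simp: order_complex_iff)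
        then show ?thesis using iso[of "\<iota> y" "\<iota> z"] \<pi>\<iota> bij_betwE[OF \<iota>] by auto
      qed
      then show "\<iota> ` ?\<sigma> \<in> order_complex A"
        using \<sigma> sub bij_betwE[OF \<iota>] by (auto simp: order_complex_iff)
      show "0 \<le> pull s w" for w using geom_nonneg[OF s] by (simp add: pull_def)
      show "pull s w = 0" if "w \<notin> \<iota> ` ?\<sigma>" for w
        using that \<iota>\<pi>[of w] by (force simp: pull_def image_iff)
      have inj: "inj_on \<iota> ?\<sigma>" using \<iota> sub by (auto simp: bij_betw_def intro: inj_on_subset)
      have "sum (pull s) (\<iota> ` ?\<sigma>) = sum s ?\<sigma>"
        unfolding sum.reindex[OF inj] o_def
        using sub bij_betwE[OF \<iota>] \<pi>\<iota> by (intro sum.cong) (auto simp: pull_def)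
      then show "sum (pull s) (\<iota> ` ?\<sigma>) = 1" using s by (simp add: geom_def)
    qed
  qed
  have push: "push t \<in> geom (order_complex B)" if t: "t \<in> geom (order_complex A)" for t
  proof -
    let ?\<sigma> = "{z. t z \<noteq> 0}"
    have \<sigma>: "?\<sigma> \<in> order_complex A" using t by (rule geom_support)
    then have sub: "?\<sigma> \<subseteq> A" by (simp add: order_complex_iff)
    show ?thesis
    proof (rule geomI[OF simplicial_order_complex, of "\<pi> ` ?\<sigma>"])
      have "\<pi> y \<le> \<pi> z \<or> \<pi> z \<le> \<pi> y" if "y \<in> ?\<sigma>" "z \<in> ?\<sigma>" for y z
      proof -
        have yz: "y \<in> A" "z \<in> A" "y \<le> z \<or> z \<le> y" using that \<sigma> sub by (auto simp: order_complex_iff)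
        then show ?thesis using iso[of y z] by auto
      qed
      then show "\<pi> ` ?\<sigma> \<in> order_complex B"
        using \<sigma> sub bij_betwE[OF \<pi>] by (auto simp: order_complex_iff)
      show "0 \<le> push t w" for w using geom_nonneg[OF t] by (simp add: push_def)
      show "push t w = 0" if "w \<notin> \<pi> ` ?\<sigma>" for w
        using that \<pi>\<iota>[of w] by (force simp: push_def image_iff)
      have inj: "inj_on \<pi> ?\<sigma>" using \<pi> sub by (auto simp: bij_betw_def intro: inj_on_subset)
      have "sum (push t) (\<pi> ` ?\<sigma>) = sum t ?\<sigma>"
        unfolding sum.reindex[OF inj] o_def
        using sub bij_betwE[OF \<pi>] \<iota>\<pi> by (intro sum.cong) (auto simp: push_def)
      then show "sum (push t) (\<pi> ` ?\<sigma>) = 1" using t by (simp add: geom_def)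
    qed
  qed
  have "pull (push t) = t" if t: "t \<in> geom (order_complex A)" for t
  proof
    fix w
    have "t w = 0" if "w \<notin> A" using geom_support[OF t] that by (auto simp: order_complex_iff)
    then show "pull (push t) w = t w"
      using \<iota>\<pi>[of w] bij_betwE[OF \<pi>] by (auto simp: pull_def push_def)
  qed
  then show ?thesis
    using pull push by (intro k_connected_retract[OF B cont_pull _ cont_push]) auto
qed

lemma complex_dim_order_complex_iso:
  fixes A :: "'a::order set" and B :: "'b::order set"
  assumes "finite A" and \<pi>: "bij_betw \<pi> A B"
    and iso: "\<And>y z. y \<in> A \<Longrightarrow> z \<in> A \<Longrightarrow> y \<le> z \<or> z \<le> y \<longleftrightarrow> \<pi> y \<le> \<pi> z \<or> \<pi> z \<le> \<pi> y"
  shows "complex_dim (order_complex A) \<le> complex_dim (order_complex B)"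
proof (rule complex_dim_order_complex_le[OF assms(1)])
  fix C assume C: "C \<in> order_complex A"
  have "\<pi> y \<le> \<pi> z \<or> \<pi> z \<le> \<pi> y" if "y \<in> C" "z \<in> C" for y z
    using C iso[of y z] that by (auto simp: order_complex_iff subset_iff)
  then have "\<pi> ` C \<in> order_complex B"
    using C bij_betwE[OF \<pi>] by (auto simp: order_complex_iff)
  moreover have "finite B" using assms(1) \<pi> bij_betw_finite by blast
  moreover have "card (\<pi> ` C) = card C"
    using C \<pi> by (intro card_image) (auto simp: order_complex_iff bij_betw_def intro: inj_on_subset)
  ultimately show "int (card C) \<le> complex_dim (order_complex B) + 1"
    using complex_dim_order_complex_ge[of B "\<pi> ` C"] by simp
qed

section \<open>Maximal chains\<close>

lemma maxchain_iff:
  fixes A :: "'a::order set"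
  shows "pred_on.maxchain A (\<le>) C \<longleftrightarrow> C \<subseteq> A \<and> (\<forall>y\<in>C. \<forall>z\<in>C. y \<le> z \<or> z \<le> y) \<and>
    (\<forall>z\<in>A. (\<forall>y\<in>C. y \<le> z \<or> z \<le> y) \<longrightarrow> z \<in> C)" (is "_ \<longleftrightarrow> ?R")
proof
  assume m: "pred_on.maxchain A (\<le>) C"
  then have C: "pred_on.chain A (\<le>) C" and no: "\<And>S. pred_on.chain A (\<le>) S \<Longrightarrow> \<not> C \<subset> S"
    by (auto simp: pred_on.maxchain_def)
  have "z \<in> C" if z: "z \<in> A" "\<forall>y\<in>C. y \<le> z \<or> z \<le> y" for z
  proof (rule ccontr)
    assume "z \<notin> C"
    moreover have "pred_on.chain A (\<le>) (insert z C)" using C z by (auto simp: chain_iff)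
    ultimately show False using no by blast
  qed
  then show ?R using C by (simp add: chain_iff)
next
  assume R: ?R
  have False if S: "pred_on.chain A (\<le>) S" "C \<subset> S" for S
  proof -
    obtain z where "z \<in> S" "z \<notin> C" using S(2) by blast
    moreover have "z \<in> A" "\<forall>y\<in>C. y \<le> z \<or> z \<le> y"
      using S \<open>z \<in> S\<close> unfolding chain_iff by blast+
    ultimately show False using R by blast
  qed
  moreover have "pred_on.chain A (\<le>) C" using R by (simp add: chain_iff)
  ultimately show "pred_on.maxchain A (\<le>) C" unfolding pred_on.maxchain_def by blast
qed

lemma chain_subset_maxchain:
  assumes A: "finite A" and C: "C \<in> order_complex A"
  shows "\<exists>E. pred_on.maxchain A (\<le>) E \<and> C \<subseteq> E"
proof -
  obtain E where E: "E \<in> order_complex A" "C \<subseteq> E"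
    "\<And>E'. E' \<in> order_complex A \<Longrightarrow> E \<subseteq> E' \<Longrightarrow> E = E'"
    using finite_has_maximal2[OF finite_order_complex[OF A] C] by blast
  have "z \<in> E" if "z \<in> A" "\<forall>y\<in>E. y \<le> z \<or> z \<le> y" for z
  proof -
    have "insert z E \<in> order_complex A" using E(1) that by (auto simp: order_complex_iff)
    then show ?thesis using E(3) by blast
  qed
  then have "pred_on.maxchain A (\<le>) E" using E(1) unfolding maxchain_iff order_complex_iff by blast
  then show ?thesis using E(2) by blast
qed

lemma homotopy_CM_iff:
  "homotopy_CM A \<longleftrightarrow> (\<forall>F\<in>order_complex A. k_connected (complex_dim (order_complex (link_poset A F)) - 1)
      (top_of_set (geom (order_complex (link_poset A F)))))"
  by (simp add: homotopy_CM_def homotopy_CM_complex_def link_order_complex realization_eq)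

section \<open>The pruned product\<close>

lemma finite_chain_has_greatest:
  fixes C :: "'a::order set"
  assumes "finite C" "C \<noteq> {}" "\<And>y z. y \<in> C \<Longrightarrow> z \<in> C \<Longrightarrow> y \<le> z \<or> z \<le> y"
  shows "\<exists>p\<in>C. \<forall>z\<in>C. z \<le> p"
  using finite_has_maximal[OF assms(1,2)] assms(3) by metis

lemma finite_chain_has_least:
  fixes C :: "'a::order set"
  assumes "finite C" "C \<noteq> {}" "\<And>y z. y \<in> C \<Longrightarrow> z \<in> C \<Longrightarrow> y \<le> z \<or> z \<le> y"
  shows "\<exists>p\<in>C. \<forall>z\<in>C. p \<le> z"
  using finite_has_minimal[OF assms(1,2)] assms(3) by metis

text \<open>An element comparable to everything lies in each maximal chain. In the application
  \<open>T\<close> holds the minimum and the maximum, if any, and \<open>X\<close> is a further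
  deletion.\<close>

lemma maxchain_remove_comparable:
  fixes P :: "'a::order set"
  assumes T: "T \<subseteq> P" "\<And>t z. t \<in> T \<Longrightarrow> z \<in> P \<Longrightarrow> t \<le> z \<or> z \<le> t" and X: "X \<inter> T = {}"
    and E: "pred_on.maxchain (P - X) (\<le>) E"
  shows "T \<subseteq> E" "pred_on.maxchain (P - T - X) (\<le>) (E - T)"
proof -
  have EP: "E \<subseteq> P - X" and Ech: "\<And>y z. y \<in> E \<Longrightarrow> z \<in> E \<Longrightarrow> y \<le> z \<or> z \<le> y"
    and Emax: "\<And>z. z \<in> P - X \<Longrightarrow> (\<And>y. y \<in> E \<Longrightarrow> y \<le> z \<or> z \<le> y) \<Longrightarrow> z \<in> E"
    using E unfolding maxchain_iff by blast+
  show "T \<subseteq> E"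
  proof
    fix t assume t: "t \<in> T"
    show "t \<in> E"
    proof (rule Emax)
      show "y \<le> t \<or> t \<le> y" if "y \<in> E" for y using T(2)[OF t, of y] that EP by blast
    qed (use t T(1) X in blast)
  qed
  show "pred_on.maxchain (P - T - X) (\<le>) (E - T)"
    unfolding maxchain_iff
  proof (intro conjI ballI impI)
    fix z assume z: "z \<in> P - T - X" "\<forall>y\<in>E - T. y \<le> z \<or> z \<le> y"
    have "z \<in> E"
    proof (rule Emax)
      show "y \<le> z \<or> z \<le> y" if "y \<in> E" for y
        using T(2)[of y z] z that by (cases "y \<in> T") auto
    qed (use z in blast)
    then show "z \<in> E - T" using z by blast
  qed (use EP Ech in auto)
qed

lemma maxchain_add_comparable:
  fixes P :: "'a::order set"
  assumes T: "T \<subseteq> P" "\<And>t z. t \<in> T \<Longrightarrow> z \<in> P \<Longrightarrow> t \<le> z \<or> z \<le> t"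
    and E: "pred_on.maxchain (P - T) (\<le>) E"
  shows "pred_on.maxchain P (\<le>) (E \<union> T)"
proof -
  have EP: "E \<subseteq> P - T" and Ech: "\<And>y z. y \<in> E \<Longrightarrow> z \<in> E \<Longrightarrow> y \<le> z \<or> z \<le> y"
    and Emax: "\<And>z. z \<in> P - T \<Longrightarrow> (\<And>y. y \<in> E \<Longrightarrow> y \<le> z \<or> z \<le> y) \<Longrightarrow> z \<in> E"
    using E unfolding maxchain_iff by blast+
  show ?thesis
    unfolding maxchain_iff
  proof (intro conjI ballI impI)
    fix y z assume "y \<in> E \<union> T" "z \<in> E \<union> T"
    then show "y \<le> z \<or> z \<le> y" using Ech[of y z] T(2)[of y z] T(2)[of z y] T(1) EP by blast
  next
    fix z assume "z \<in> P" "\<forall>y\<in>E \<union> T. y \<le> z \<or> z \<le> y"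
    then show "z \<in> E \<union> T" using Emax[of z] by blast
  qed (use EP T in auto)
qed

text \<open>Removing \<open>T\<close> from a maximal chain of \<open>P - {x}\<close> leaves a
  maximal chain of \<open>P - T - {x}\<close>, whose length is \<open>r\<close>. Adding
  \<open>T\<close> to one maximal chain of \<open>P - T\<close> gives
  \<open>n = r + card T\<close>.\<close>

lemma has_rank_delete_point:
  fixes P :: "'a::order set"
  assumes P: "finite P" "has_rank P n"
    and T: "T \<subseteq> P" "\<And>t z. t \<in> T \<Longrightarrow> z \<in> P \<Longrightarrow> t \<le> z \<or> z \<le> t" and x: "x \<in> P - T"
    and r: "has_rank (P - T) r" "has_rank (P - T - {x}) r"
  shows "has_rank (P - {x}) n"
  unfolding has_rank_def
proof (intro allI impI)
  fix E assume E: "pred_on.maxchain (P - {x}) (\<le>) E"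
  have finT: "finite T" using T(1) P(1) finite_subset by blast
  have "{} \<in> order_complex (P - T)" by (simp add: order_complex_iff)
  then obtain E' where E': "pred_on.maxchain (P - T) (\<le>) E'"
    using chain_subset_maxchain[of "P - T" "{}"] P(1) by blast
  have "int (card E') - 1 = r" "finite E'" using r(1) E' by (auto simp: has_rank_def)
  moreover have "int (card (E' \<union> T)) - 1 = n"
    using P(2) maxchain_add_comparable[OF T E'] by (auto simp: has_rank_def)
  moreover have "E' \<inter> T = {}" using E' unfolding maxchain_iff by blast
  ultimately have n: "r + int (card T) = n" using finT by (simp add: card_Un_disjoint)
  have X: "{x} \<inter> T = {}" using x by blast
  have "finite E" using E P(1) unfolding maxchain_iff by (meson finite_Diff finite_subset)
  moreover have "int (card (E - T)) - 1 = r"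
    using r(2) maxchain_remove_comparable(2)[OF T X E] by (auto simp: has_rank_def)
  moreover have "T \<subseteq> E" by (rule maxchain_remove_comparable(1)[OF T X E])
  moreover have "card T \<le> card E" using \<open>finite E\<close> \<open>T \<subseteq> E\<close> by (rule card_mono)
  ultimately show "finite E \<and> int (card E) - 1 = n"
    using n finT by (simp add: card_Diff_subset)
qed

text \<open>A maximal chain climbs level 0 up to some \<open>p\<close>, steps to
  \<open>(p, True)\<close> and continues on level 1. Its projection identifies only the two copies
  of \<open>p\<close>, so it is shorter by one, and it is a maximal chain of \<open>P\<close> or of
  \<open>P - {x}\<close>.\<close>

lemma has_rank_product_delete:
  fixes P :: "'a::order set"
  assumes P: "finite P" "has_rank P n" "has_rank (P - {x}) n"
    and b: "b \<in> P" "\<And>y. y \<in> P \<Longrightarrow> b \<le> y" "b \<noteq> x"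
  shows "has_rank (P \<times> (UNIV :: bool set) - {(x, False)}) (n + 1)"
  unfolding has_rank_def
proof (intro allI impI)
  let ?Q = "P \<times> (UNIV :: bool set) - {(x, False)}"
  fix C assume C: "pred_on.maxchain ?Q (\<le>) C"
  have CQ: "C \<subseteq> ?Q" and Cch: "\<And>y z. y \<in> C \<Longrightarrow> z \<in> C \<Longrightarrow> y \<le> z \<or> z \<le> y"
    and Cmax: "\<And>z. z \<in> ?Q \<Longrightarrow> (\<And>y. y \<in> C \<Longrightarrow> y \<le> z \<or> z \<le> y) \<Longrightarrow> z \<in> C"
    using C unfolding maxchain_iff by blast+
  have finC: "finite C" using CQ P(1) by (meson finite_Diff finite_SigmaI finite_UNIV finite_subset finite)
  define C0 where "C0 = {z. (z, False) \<in> C}"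
  define C1 where "C1 = {z. (z, True) \<in> C}"
  have Ceq: "C = (\<lambda>z. (z, False)) ` C0 \<union> (\<lambda>z. (z, True)) ` C1"
  proof (intro equalityI subsetI)
    fix w assume "w \<in> C"
    then show "w \<in> (\<lambda>z. (z, False)) ` C0 \<union> (\<lambda>z. (z, True)) ` C1"
      by (cases w; cases "snd w") (auto simp: C0_def C1_def)
  qed (auto simp: C0_def C1_def)
  have fin: "finite C0" "finite C1"
    using finite_imageI[OF finC, of fst] by (auto simp: C0_def C1_def elim!: rev_finite_subset intro: rev_image_eqI)
  have sub: "C0 \<subseteq> P - {x}" "C1 \<subseteq> P" using CQ by (auto simp: C0_def C1_def)
  have "(b, False) \<in> C"
    by (rule Cmax) (use b CQ in \<open>auto simp: subset_iff\<close>)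
  then have "C0 \<noteq> {}" by (auto simp: C0_def)
  moreover have C0ch: "y \<le> z \<or> z \<le> y" if "y \<in> C0" "z \<in> C0" for y z
    using Cch[of "(y, False)" "(z, False)"] that by (auto simp: C0_def)
  ultimately obtain p where p: "p \<in> C0" "\<And>z. z \<in> C0 \<Longrightarrow> z \<le> p"
    using finite_chain_has_greatest[OF fin(1)] by blast
  have C1ch: "y \<le> z \<or> z \<le> y" if "y \<in> C1" "z \<in> C1" for y z
    using Cch[of "(y, True)" "(z, True)"] that by (auto simp: C1_def)
  have C1p: "p \<le> z" if "z \<in> C1" for z
    using Cch[of "(p, False)" "(z, True)"] that p(1) by (auto simp: C0_def C1_def)
  have "(p, True) \<in> C"
  proof (rule Cmax)
    fix y assume "y \<in> C"
    then show "y \<le> (p, True) \<or> (p, True) \<le> y" using p(2) C1p unfolding Ceq by auto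
  qed (use p sub in auto)
  then have p1: "p \<in> C1" by (simp add: C1_def)
  let ?E = "C0 \<union> C1"
  have "C0 \<inter> C1 = {p}" using p p1 C1p by (auto intro: antisym)
  then have "card C0 + card C1 = card ?E + 1" using card_Un_Int[OF fin] by simp
  moreover have "card C = card C0 + card C1"
    unfolding Ceq using fin by (subst card_Un_disjoint) (auto simp: card_image inj_on_def)
  ultimately have cardC: "card C = card ?E + 1" by simp
  \<comment> \<open>Below \<open>p\<close> the chain uses level 0, where \<open>x\<close> is
    missing; above \<open>p\<close> it uses level 1, where \<open>x\<close> is available.\<close>
  define X where "X = (if x < p then {x} else {})"
  have "pred_on.maxchain (P - X) (\<le>) ?E"
    unfolding maxchain_iff
  proof (intro conjI ballI impI)
    show "?E \<subseteq> P - X" using sub C1p[of x] by (auto simp: X_def)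
    fix y z assume "y \<in> ?E" "z \<in> ?E"
    then show "y \<le> z \<or> z \<le> y"
      using C0ch[of y z] C1ch[of y z] p(2)[of y] p(2)[of z] C1p[of y] C1p[of z] by (auto intro: order_trans)
  next
    fix z assume z: "z \<in> P - X" "\<forall>y\<in>?E. y \<le> z \<or> z \<le> y"
    then consider "z = p" | "z < p" | "p < z" using p(1) by (auto simp: order.order_iff_strict)
    then show "z \<in> ?E"
    proof cases
      case 2
      have "(z, False) \<in> C"
      proof (rule Cmax)
        show "(z, False) \<in> ?Q" using z(1) 2 by (auto simp: X_def)
        fix y assume "y \<in> C"
        then show "y \<le> (z, False) \<or> (z, False) \<le> y"
          using z(2) order_trans[OF less_imp_le[OF 2] C1p] unfolding Ceq by auto
      qed
      then show ?thesis by (simp add: C0_def)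
    next
      case 3
      have "(z, True) \<in> C"
      proof (rule Cmax)
        show "(z, True) \<in> ?Q" using z(1) by auto
        fix y assume "y \<in> C"
        then show "y \<le> (z, True) \<or> (z, True) \<le> y"
          using z(2) order_trans[OF p(2) less_imp_le[OF 3]] unfolding Ceq by auto
      qed
      then show ?thesis by (simp add: C1_def)
    qed (use p in simp)
  qed
  then have "int (card ?E) - 1 = n" using P by (auto simp: has_rank_def X_def split: if_splits)
  then show "finite C \<and> int (card C) - 1 = n + 1" using finC cardC by simp
qed

section \<open>Connectivity of links in the pruned product\<close>

lemma k_connected_order_complex_contractible:
  assumes "c \<in> A" "contractible (geom (order_complex A))"
  shows "k_connected k (top_of_set (geom (order_complex A)))"
proof (rule contractible_imp_k_connected[OF assms(2)])
  have "{c} \<in> order_complex A" using assms(1) by (simp add: order_complex_iff)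
  then show "geom (order_complex A) \<noteq> {}" using geom_vertex[OF simplicial_order_complex] by blast
qed

text \<open>The closure operator sends \<open>(z, e)\<close> to \<open>(max z p, True)\<close>, the
  maximum existing because \<open>z\<close> and \<open>p\<close> are comparable. Its least value is
  \<open>(p, True)\<close>, and \<open>up\<close> keeps it inside \<open>S\<close>.\<close>

lemma contractible_two_levels:
  fixes S :: "('a::order \<times> bool) set"
  assumes S: "finite S" "(p, True) \<in> S"
    and cmp: "\<And>z e. (z, e) \<in> S \<Longrightarrow> z \<le> p \<or> p \<le> z"
    and up: "\<And>z e. (z, e) \<in> S \<Longrightarrow> \<not> z \<le> p \<Longrightarrow> (z, True) \<in> S"
  shows "contractible (geom (order_complex S))"
proof (rule contractible_order_complex_closure[OF S, of "\<lambda>(z, e). (if z \<le> p then p else z, True)"])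
  fix w w' assume "w \<in> S" "w' \<in> S" "w \<le> w'"
  moreover obtain z e z' e' where "w = (z, e)" "w' = (z', e')" by (cases w; cases w')
  ultimately show "(case w of (z, e) \<Rightarrow> (if z \<le> p then p else z, True)) \<le>
      (case w' of (z, e) \<Rightarrow> (if z \<le> p then p else z, True))"
    using cmp[of z' e'] by (auto intro: order_trans)
next
  fix w assume w: "w \<in> S"
  obtain z e where "w = (z, e)" by (cases w)
  then show "(p, True) \<le> (case w of (z, e) \<Rightarrow> (if z \<le> p then p else z, True))"
    using cmp[of z e] w by auto
qed (use S up in \<open>auto simp: less_eq_prod_def\<close>)

text \<open>With both copies of \<open>q\<close> in the chain, the link has only elements below
  \<open>q\<close> on level 0 and above \<open>q\<close> on level 1. The first coordinate thus
  determines the level, and projection identifies \<open>L\<close> with the link of the projected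
  chain in \<open>P - T\<close> or \<open>P - T - {x}\<close>.\<close>

lemma link_poset_product_k_connected:
  fixes P :: "'a::order set"
  assumes P: "finite P"
    and T: "T \<subseteq> P" "\<And>t z. t \<in> T \<Longrightarrow> z \<in> P \<Longrightarrow> t \<le> z \<or> z \<le> t"
    and CM: "homotopy_CM (P - T)" "homotopy_CM (P - T - {x})"
    and G: "G \<in> order_complex (P \<times> (UNIV :: bool set) - {(x, False)})"
    and q: "(q, False) \<in> G" "(q, True) \<in> G" and TG: "T \<subseteq> fst ` G"
  defines "L \<equiv> link_poset (P \<times> (UNIV :: bool set) - {(x, False)}) G"
  shows "k_connected (complex_dim (order_complex L) - 1) (top_of_set (geom (order_complex L)))"
proof -
  let ?Q = "P \<times> (UNIV :: bool set) - {(x, False)}"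
  let ?D = "fst ` G"
  have GQ: "G \<subseteq> ?Q" and finG: "finite G"
    and Gch: "\<And>y z. y \<in> G \<Longrightarrow> z \<in> G \<Longrightarrow> y \<le> z \<or> z \<le> y"
    using G unfolding order_complex_iff by blast+
  have down: "z \<le> q" if "(z, False) \<in> G" for z using Gch[OF that q(2)] by auto
  have up: "q \<le> z" if "(z, True) \<in> G" for z using Gch[OF that q(1)] by auto
  have D: "z \<in> ?D \<longleftrightarrow> (z, False) \<in> G \<or> (z, True) \<in> G" for z
  proof
    assume "z \<in> ?D"
    then obtain e where "(z, e) \<in> G" by auto
    then show "(z, False) \<in> G \<or> (z, True) \<in> G" by (cases e) auto
  qed force
  have Dch: "y \<le> z \<or> z \<le> y" if "y \<in> ?D" "z \<in> ?D" for y z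
    using that Gch by (fastforce simp: less_eq_prod_def)
  have qD: "q \<in> ?D" using q D by blast
  \<comment> \<open>Below \<open>q\<close> the link lives on level 0, where \<open>x\<close> is
    missing; above \<open>q\<close> it lives on level 1.\<close>
  define X where "X = (if x < q then {x} else {})"
  have XD: "X \<inter> ?D = {}" using up[of x] GQ by (auto simp: X_def D)
  \<comment> \<open>The projected chain contains \<open>T\<close>, whose elements are comparable to
    everything; discarding \<open>T\<close> from both poset and chain leaves the link
    unchanged.\<close>
  define M where "M = link_poset (P - T - X) (?D - T)"
  have M: "z \<in> M \<longleftrightarrow> z \<in> P \<and> z \<notin> X \<and> z \<notin> ?D \<and> (\<forall>a\<in>?D. z \<le> a \<or> a \<le> z)" for z
    using TG T(2) unfolding M_def link_poset_def by blast
  have "?D - T \<in> order_complex (P - T - X)"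
    using finG GQ XD Dch unfolding order_complex_iff by auto
  moreover have "homotopy_CM (P - T - X)" using CM by (simp add: X_def)
  ultimately have connM: "k_connected (complex_dim (order_complex M) - 1) (top_of_set (geom (order_complex M)))"
    unfolding homotopy_CM_iff M_def by blast
  have Lmem: "w \<in> L \<longleftrightarrow> w \<in> ?Q \<and> w \<notin> G \<and> (\<forall>a\<in>G. w \<le> a \<or> a \<le> w)" for w
    by (auto simp: L_def link_poset_def)
  have L0: "(z, False) \<in> L \<longleftrightarrow> z \<in> M \<and> z < q" for z
  proof
    assume z: "(z, False) \<in> L"
    have "z \<le> q" using z q(2) by (fastforce simp: Lmem)
    moreover have "z \<noteq> q" using z q(1) by (auto simp: Lmem)
    ultimately have zq: "z < q" by simp
    have "z \<le> a \<or> a \<le> z" if "a \<in> ?D" for a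
      using z that by (fastforce simp: Lmem less_eq_prod_def)
    moreover have "z \<notin> ?D" using z zq up[of z] by (auto simp: D Lmem)
    moreover have "z \<in> P" "z \<notin> X" using z by (auto simp: Lmem X_def)
    ultimately show "z \<in> M \<and> z < q" unfolding M using zq by blast
  next
    assume z: "z \<in> M \<and> z < q"
    then have "(z, False) \<in> ?Q" "(z, False) \<notin> G" by (auto simp: M X_def D)
    moreover have "(z, False) \<le> w \<or> w \<le> (z, False)" if "w \<in> G" for w
    proof -
      obtain a e where w: "w = (a, e)" by (cases w)
      have "a \<in> ?D" using that w by force
      then have "z \<le> a \<or> a \<le> z" using z by (simp only: M)
      moreover have "z \<le> a" if e using up[of a] z \<open>w \<in> G\<close> w that by auto
      ultimately show ?thesis using w by (cases e) auto
    qed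
    ultimately show "(z, False) \<in> L" unfolding Lmem by blast
  qed
  have L1: "(z, True) \<in> L \<longleftrightarrow> z \<in> M \<and> q < z" for z
  proof
    assume z: "(z, True) \<in> L"
    have "q \<le> z" using z q(1) by (fastforce simp: Lmem)
    moreover have "z \<noteq> q" using z q(2) by (auto simp: Lmem)
    ultimately have zq: "q < z" by simp
    have "z \<le> a \<or> a \<le> z" if "a \<in> ?D" for a
      using z that by (fastforce simp: Lmem less_eq_prod_def)
    moreover have "z \<notin> ?D" using z zq down[of z] by (auto simp: D Lmem)
    moreover have "z \<in> P" "z \<notin> X" using z zq by (auto simp: Lmem X_def)
    ultimately show "z \<in> M \<and> q < z" unfolding M using zq by blast
  next
    assume z: "z \<in> M \<and> q < z"
    then have "(z, True) \<in> ?Q" "(z, True) \<notin> G" by (auto simp: M D)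
    moreover have "(z, True) \<le> w \<or> w \<le> (z, True)" if "w \<in> G" for w
    proof -
      obtain a e where w: "w = (a, e)" by (cases w)
      have "a \<in> ?D" using that w by force
      then have "z \<le> a \<or> a \<le> z" using z by (simp only: M)
      moreover have "a \<le> z" if "\<not> e" using down[of a] z \<open>w \<in> G\<close> w that by auto
      ultimately show ?thesis using w by (cases e) auto
    qed
    ultimately show "(z, True) \<in> L" unfolding Lmem by blast
  qed
  have L: "(z, e) \<in> L \<longleftrightarrow> z \<in> M \<and> (if e then q < z else z < q)" for z e
    using L0 L1 by (cases e) auto
  have Mq: "z < q \<or> q < z" if "z \<in> M" for z
    using that qD by (auto simp: M order.order_iff_strict)
  have bij: "bij_betw fst L M"
    unfolding bij_betw_def
  proof
    show "inj_on fst L"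
      by (auto simp: inj_on_def L split: if_splits)
    show "fst ` L = M"
    proof (intro equalityI subsetI)
      fix z assume "z \<in> M"
      then have "(z, q < z) \<in> L" using Mq[of z] by (auto simp: L)
      then show "z \<in> fst ` L" by force
    qed (auto simp: L)
  qed
  have iso: "w \<le> w' \<or> w' \<le> w \<longleftrightarrow> fst w \<le> fst w' \<or> fst w' \<le> fst w" if "w \<in> L" "w' \<in> L" for w w'
  proof -
    obtain z e z' e' where w: "w = (z, e)" "w' = (z', e')" by (cases w; cases w')
    have "e \<longrightarrow> e'" if "z \<le> z'" using that \<open>w \<in> L\<close> \<open>w' \<in> L\<close> by (auto simp: w L split: if_splits)
    moreover have "e' \<longrightarrow> e" if "z' \<le> z" using that \<open>w \<in> L\<close> \<open>w' \<in> L\<close> by (auto simp: w L split: if_splits)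
    ultimately show ?thesis by (auto simp: w)
  qed
  have "finite L" using P by (auto simp: L_def link_poset_def)
  \<comment> \<open>An upper bound for the dimension suffices, since connectivity in a higher degree
    implies it in lower ones.\<close>
  then have "complex_dim (order_complex L) \<le> complex_dim (order_complex M)"
    by (rule complex_dim_order_complex_iso[OF _ bij iso])
  then show ?thesis
    using k_connected_order_complex_iso[OF bij iso connM] k_connected_mono by fastforce
qed

text \<open>All maximal chains have \<open>r + 1\<close> elements, so the link of a chain with
  \<open>m\<close> elements has dimension \<open>r - m\<close>. The dimension lost by inserting
  \<open>v\<close> matches the degree gained in \<open>k_connected_cone_attachment\<close>.\<close>

lemma complex_dim_link_poset_insert:
  fixes Q :: "'a::order set"
  assumes Q: "finite Q" "has_rank Q r" and G: "insert v F \<in> order_complex Q" "v \<notin> F"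
  shows "complex_dim (order_complex (link_poset Q F)) \<le> complex_dim (order_complex (link_poset Q (insert v F))) + 1"
proof (rule complex_dim_order_complex_le)
  show "finite (link_poset Q F)" using Q(1) by (auto simp: link_poset_def)
  have fin: "finite (link_poset Q (insert v F))" using Q(1) by (auto simp: link_poset_def)
  have finF: "finite F" using G by (auto simp: order_complex_iff)
  have max_card: "\<exists>E. C \<subseteq> E \<and> E \<in> order_complex Q \<and> int (card E) = r + 1" if C: "C \<in> order_complex Q" for C
  proof -
    obtain E where E: "pred_on.maxchain Q (\<le>) E" "C \<subseteq> E" using chain_subset_maxchain[OF Q(1) C] by blast
    then have "finite E \<and> int (card E) - 1 = r" using Q(2) by (simp add: has_rank_def)
    then show ?thesis using E by (intro exI[of _ E]) (auto simp: maxchain_iff order_complex_iff)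
  qed
  obtain E where E: "insert v F \<subseteq> E" "E \<in> order_complex Q" "int (card E) = r + 1"
    using max_card[OF G(1)] by blast
  have "E - insert v F \<in> order_complex (link_poset Q (insert v F))"
    using E(1,2) unfolding order_complex_iff link_poset_def by blast
  from complex_dim_order_complex_ge[OF fin this]
  have "int (card (E - insert v F)) - 1 \<le> complex_dim (order_complex (link_poset Q (insert v F)))" .
  moreover have "finite E" using E(2) by (simp add: order_complex_iff)
  then have "int (card (E - insert v F)) = int (card E) - int (card F) - 1"
    using E(1) G(2) finF card_mono[of E "insert v F"] by (subst card_Diff_subset) (auto simp: of_nat_diff)
  ultimately have lower: "r - int (card F) - 1 \<le> complex_dim (order_complex (link_poset Q (insert v F)))"
    using E(3) by simp
  fix C assume C: "C \<in> order_complex (link_poset Q F)"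
  have "F \<in> order_complex Q"
    using G(1) simplicial_order_complex[of Q] unfolding simplicial_def by blast
  then have "C \<union> F \<in> order_complex Q"
    using C link_order_complex[of F Q] unfolding link_def by (auto simp: Un_commute)
  then obtain E' where E': "C \<union> F \<subseteq> E'" "E' \<in> order_complex Q" "int (card E') = r + 1"
    using max_card by blast
  have "card (C \<union> F) \<le> card E'" using E' by (intro card_mono) (auto simp: order_complex_iff)
  moreover have "card (C \<union> F) = card C + card F"
    using C finF by (intro card_Un_disjoint) (auto simp: order_complex_iff link_poset_def)
  ultimately show "int (card C) \<le> complex_dim (order_complex (link_poset Q (insert v F))) + 1 + 1"
    using lower E'(3) by simp
qed

text \<open>\<open>T\<close> collects the minimum and the maximum, if there is one, so that
  \<open>P - T\<close> covers both cases of the reduced poset. The rank enters through the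
  comparison of link dimensions when \<open>v\<close> joins \<open>F\<close>.\<close>

lemma homotopy_CM_product_delete:
  fixes P :: "'a::order set"
  assumes P: "finite P" and b: "b \<in> P" "\<And>y. y \<in> P \<Longrightarrow> b \<le> y"
  defines "T \<equiv> insert b {t \<in> P. \<forall>y\<in>P. y \<le> t}"
  assumes x: "x \<in> P - T" and CM: "homotopy_CM (P - T)" "homotopy_CM (P - T - {x})"
    and rank: "has_rank (P \<times> (UNIV :: bool set) - {(x, False)}) r"
  shows "homotopy_CM (P \<times> (UNIV :: bool set) - {(x, False)})"
  unfolding homotopy_CM_iff
proof
  let ?Q = "P \<times> (UNIV :: bool set) - {(x, False)}"
  have finQ: "finite ?Q" using P by simp
  have T: "T \<subseteq> P" "\<And>t z. t \<in> T \<Longrightarrow> z \<in> P \<Longrightarrow> t \<le> z \<or> z \<le> t"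
    using b by (auto simp: T_def)
  fix F assume F: "F \<in> order_complex ?Q"
  have FQ: "F \<subseteq> ?Q" and finF: "finite F"
    and Fch: "\<And>y z. y \<in> F \<Longrightarrow> z \<in> F \<Longrightarrow> y \<le> z \<or> z \<le> y"
    using F unfolding order_complex_iff by blast+
  define L where "L = link_poset ?Q F"
  have Lmem: "w \<in> L \<longleftrightarrow> w \<in> ?Q \<and> w \<notin> F \<and> (\<forall>a\<in>F. w \<le> a \<or> a \<le> w)" for w
    by (auto simp: L_def link_poset_def)
  have finL: "finite L" using finQ by (auto simp: L_def link_poset_def)
  have cone: "k_connected k (top_of_set (geom (order_complex L)))"
    if "c \<in> ?Q" "c \<notin> F" "\<And>w. w \<in> ?Q \<Longrightarrow> w \<le> c \<or> c \<le> w" for c k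
  proof (rule k_connected_order_complex_contractible)
    show "c \<in> L" unfolding Lmem using that FQ by blast
    then show "contractible (geom (order_complex L))"
      by (rule contractible_order_complex_cone) (use that(3) Lmem in blast)
  qed
  have "k_connected (complex_dim (order_complex L) - 1) (top_of_set (geom (order_complex L)))"
  proof (cases "(b, False) \<in> F \<and> (\<forall>t\<in>P. (\<forall>y\<in>P. y \<le> t) \<longrightarrow> (t, True) \<in> F)")
    case False
    then consider "(b, False) \<notin> F" | t where "t \<in> P" "\<forall>y\<in>P. y \<le> t" "(t, True) \<notin> F" by blast
    then show ?thesis
    proof cases
      case 1
      \<comment> \<open>As \<open>b\<close> differs from \<open>x\<close>, \<open>(b, False)\<close>
        is the minimum of the pruned product and serves as cone point.\<close>
      show ?thesis
        by (rule cone[OF _ 1]) (use b x in \<open>auto simp: T_def\<close>)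
    next
      case 2
      show ?thesis
        by (rule cone[OF _ 2(3)]) (use 2 in auto)
    qed
  next
    case True
    then have TF: "T \<subseteq> fst ` F" by (force simp: T_def)
    define F0 where "F0 = {z. (z, False) \<in> F}"
    define F1 where "F1 = {z. (z, True) \<in> F}"
    have fin: "finite F0" "finite F1"
      using finite_imageI[OF finF, of fst] by (auto simp: F0_def F1_def elim!: rev_finite_subset intro: rev_image_eqI)
    have F0ch: "y \<le> z \<or> z \<le> y" if "y \<in> F0" "z \<in> F0" for y z
      using Fch[of "(y, False)" "(z, False)"] that by (auto simp: F0_def)
    have F1ch: "y \<le> z \<or> z \<le> y" if "y \<in> F1" "z \<in> F1" for y z
      using Fch[of "(y, True)" "(z, True)"] that by (auto simp: F1_def)
    have "F0 \<noteq> {}" using True by (auto simp: F0_def)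
    then obtain p where p: "p \<in> F0" "\<And>z. z \<in> F0 \<Longrightarrow> z \<le> p"
      using finite_chain_has_greatest[OF fin(1) _ F0ch] by blast
    have pF: "(p, False) \<in> F" using p by (simp add: F0_def)
    have pF1: "p \<le> z" if "z \<in> F1" for z
      using Fch[of "(p, False)" "(z, True)"] that pF by (auto simp: F1_def)
    have F_cases: "(\<exists>a\<in>F0. w = (a, False)) \<or> (\<exists>a\<in>F1. w = (a, True))" if "w \<in> F" for w
      using that by (cases w; cases "snd w") (auto simp: F0_def F1_def)
    have Lp: "z \<le> p \<or> p \<le> z" if "(z, e) \<in> L" for z e
      using that pF by (fastforce simp: Lmem)
    have pL: "(p, True) \<in> L" if "p \<notin> F1"
      unfolding Lmem
    proof (intro conjI ballI)
      fix a assume "a \<in> F"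
      then show "(p, True) \<le> a \<or> a \<le> (p, True)" using F_cases[of a] p(2) pF1 by auto
    qed (use that pF FQ in \<open>auto simp: F1_def\<close>)
    \<comment> \<open>Elements of \<open>F\<close> on level 0 lie below \<open>p\<close>, hence
      below \<open>z\<close>, and those on level 1 lie above \<open>z\<close>. Only membership of
      \<open>(z, True)\<close> in \<open>F\<close> can prevent raising.\<close>
    have raise: "(z, True) \<in> L" if z: "(z, e) \<in> L" "\<not> z \<le> p" "e \<or> z \<notin> F1" for z e
    proof (cases e)
      case False
      show ?thesis
        unfolding Lmem
      proof (intro conjI ballI)
        fix a assume a: "a \<in> F"
        then consider a0 where "a0 \<in> F0" "a = (a0, False)" | a1 where "a1 \<in> F1" "a = (a1, True)"
          using F_cases by blast
        then show "(z, True) \<le> a \<or> a \<le> (z, True)"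
        proof cases
          case 1
          then show ?thesis using p(2)[of a0] Lp[OF z(1)] z(2) by (auto intro: order_trans)
        next
          case 2
          then show ?thesis using z(1) False a by (fastforce simp: Lmem)
        qed
      qed (use z False in \<open>auto simp: Lmem F1_def\<close>)
    qed (use z in simp)
    show ?thesis
    proof (cases "p \<in> F1")
      case True
      then show ?thesis
        unfolding L_def
        by (intro link_poset_product_k_connected[OF P T CM F pF _ TF]) (auto simp: F1_def)
    next
      case pnF1: False
      show ?thesis
      proof (cases "F1 = {} \<or> (x \<in> F1 \<and> (\<forall>z\<in>F1. x \<le> z))")
        case True
        \<comment> \<open>If \<open>x\<close> is the least element of \<open>F1\<close>, a blocked
          \<open>z\<close> would equal \<open>x\<close>, but \<open>(x, False)\<close> has been
          deleted. So nothing blocks raising.\<close>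
        have "z \<notin> F1" if z: "(z, False) \<in> L" for z
        proof
          assume zF: "z \<in> F1"
          then have "x \<in> F1" "x \<le> z" using True by auto
          moreover have "z \<le> x" using z \<open>x \<in> F1\<close> by (fastforce simp: Lmem F1_def)
          ultimately show False using z by (auto simp: Lmem)
        qed
        then have "contractible (geom (order_complex L))"
          using Lp raise by (intro contractible_two_levels[OF finL pL[OF pnF1]]) (blast, metis (full_types))
        then show ?thesis using pL[OF pnF1] by (intro k_connected_order_complex_contractible)
      next
        case False
        then obtain q where q: "q \<in> F1" "\<And>z. z \<in> F1 \<Longrightarrow> q \<le> z"
          using finite_chain_has_least[OF fin(2) _ F1ch] by blast
        then have qx: "q \<noteq> x" using False by blast
        \<comment> \<open>The one element of \<open>L\<close> not below \<open>p\<close> that cannot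
          be raised, because \<open>(q, True)\<close> is in \<open>F\<close>. Once it is removed the
          contraction works.\<close>
        define v where "v = (q, False)"
        have qF: "(q, True) \<in> F" using q by (simp add: F1_def)
        have pq: "p \<le> q" using pF1 q by blast
        have vF: "v \<notin> F" using p(2)[of q] pq pnF1 q(1) by (auto simp: v_def F0_def)
        have vQ: "v \<in> ?Q" using qF FQ qx by (auto simp: v_def)
        have vcmp: "v \<le> a \<or> a \<le> v" if "a \<in> F" for a
          using F_cases[OF that] order_trans[OF p(2) pq] q(2) unfolding v_def by auto
        have vL: "v \<in> L" using vQ vF vcmp by (auto simp: Lmem)
        have G: "insert v F \<in> order_complex ?Q"
          using F vQ vcmp unfolding order_complex_iff by blast
        \<comment> \<open>The enlarged chain contains both copies of \<open>q\<close>, so the link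
          of \<open>v\<close> falls under \<open>link_poset_product_k_connected\<close>.\<close>
        have linkv: "link_poset L {v} = link_poset ?Q (insert v F)"
          by (auto simp: L_def link_poset_def)
        have vK: "{v} \<in> order_complex L" using vL by (simp add: order_complex_iff)
        let ?d = "complex_dim (order_complex (link_poset ?Q (insert v F)))"
        have "k_connected ?d (top_of_set (geom (order_complex L)))"
        proof (rule k_connected_cone_attachment[OF simplicial_order_complex vK])
          have "(p, True) \<in> L - {v}" using pL[OF pnF1] by (simp add: v_def)
          moreover have "(z, True) \<in> L - {v}" if "(z, e) \<in> L - {v}" "\<not> z \<le> p" for z e
          proof -
            have "e \<or> z \<notin> F1"
            proof (rule ccontr)
              assume *: "\<not> (e \<or> z \<notin> F1)"
              then have "z \<le> q" using that(1) qF by (fastforce simp: Lmem)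
              then have "z = q" using q(2)[of z] * by simp
              then show False using that(1) * by (simp add: v_def)
            qed
            then show ?thesis using raise[of z e] that by (auto simp: v_def)
          qed
          ultimately have "contractible (geom (order_complex (L - {v})))"
            using Lp finL by (intro contractible_two_levels[of _ p]) auto
          then show "contractible (geom {\<sigma> \<in> order_complex L. v \<notin> \<sigma>})"
            by (simp add: deletion_order_complex)
          have "k_connected (?d - 1) (top_of_set (geom (order_complex (link_poset ?Q (insert v F)))))"
            by (rule link_poset_product_k_connected[OF P T CM G, of q]) (use qF TF in \<open>auto simp: v_def\<close>)
          then show "k_connected (?d - 1) (top_of_set (geom (link (order_complex L) {v})))"
            by (simp add: link_order_complex[OF vK] linkv)
        qed
        moreover have "complex_dim (order_complex L) \<le> ?d + 1"
          unfolding L_def by (rule complex_dim_link_poset_insert[OF finQ rank G vF])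
        ultimately show ?thesis using k_connected_mono by fastforce
      qed
    qed
  qed
  then show "k_connected (complex_dim (order_complex (link_poset ?Q F)) - 1)
      (top_of_set (geom (order_complex (link_poset ?Q F))))" by (simp only: L_def)
qed

text \<open>The set of all maxima is empty or a singleton, so one formula covers both cases of the
  definition.\<close>

lemma reduced_poset_eq:
  fixes P :: "'a::order set"
  assumes b: "b \<in> P" "\<And>y. y \<in> P \<Longrightarrow> b \<le> y"
  shows "reduced_poset P = P - insert b {t \<in> P. \<forall>y\<in>P. y \<le> t}"
proof -
  have least: "(LEAST y. y \<in> P) = b" by (rule Least_equality) (use b in auto)
  show ?thesis
  proof (cases "has_maximum P")
    case True
    then obtain t where t: "t \<in> P" "\<And>y. y \<in> P \<Longrightarrow> y \<le> t" by (auto simp: has_maximum_def)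
    have "(GREATEST y. y \<in> P) = t" by (rule Greatest_equality) (use t in auto)
    moreover have "{t \<in> P. \<forall>y\<in>P. y \<le> t} = {t}" using t by (auto intro: antisym)
    ultimately show ?thesis using True by (simp add: reduced_poset_def least)
  next
    case False
    then have none: "{t \<in> P. \<forall>y\<in>P. y \<le> t} = {}" by (auto simp: has_maximum_def)
    show ?thesis unfolding reduced_poset_def least none using False by simp
  qed
qed

theorem theorem4p1:
  fixes P :: "'a::order set" and n :: nat and x :: 'a
  assumes "finite P"
    and "has_rank P (int n)"
    and "has_minimum P"
    and "doubly_homotopy_CM (reduced_poset P)"
    and "x \<in> reduced_poset P"
  shows "homotopy_CM (P \<times> (UNIV :: bool set) - {(x, False)}) \<and>
         has_rank (P \<times> (UNIV :: bool set) - {(x, False)}) (int n + 1)"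
proof -
  obtain b where b: "b \<in> P" "\<And>y. y \<in> P \<Longrightarrow> b \<le> y"
    using assms(3) by (auto simp: has_minimum_def)
  define T where "T = insert b {t \<in> P. \<forall>y\<in>P. y \<le> t}"
  have R: "reduced_poset P = P - T" unfolding T_def by (rule reduced_poset_eq[OF b])
  have x: "x \<in> P - T" using assms(5) R by simp
  \<comment> \<open>Double Cohen-Macaulayness at \<open>y = x\<close> yields the property for
    \<open>P - T - {x}\<close> and a rank common to both posets.\<close>
  have CM: "homotopy_CM (P - T)" "homotopy_CM (P - T - {x})"
    and "\<exists>r. has_rank (P - T) r \<and> has_rank (P - T - {x}) r"
    using assms(4) x unfolding doubly_homotopy_CM_def R by auto
  then obtain r where r: "has_rank (P - T) r" "has_rank (P - T - {x}) r" by blast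
  have T: "T \<subseteq> P" "\<And>t z. t \<in> T \<Longrightarrow> z \<in> P \<Longrightarrow> t \<le> z \<or> z \<le> t"
    using b by (auto simp: T_def)
  \<comment> \<open>This accounts for maximal chains of the product that stay on level 0 beyond
    \<open>x\<close>, whose projections avoid \<open>x\<close>.\<close>
  have "has_rank (P - {x}) (int n)"
    by (rule has_rank_delete_point[OF assms(1,2) T x r])
  then have rank: "has_rank (P \<times> (UNIV :: bool set) - {(x, False)}) (int n + 1)"
    using x by (intro has_rank_product_delete[OF assms(1,2) _ b]) (auto simp: T_def)
  then show ?thesis
    using homotopy_CM_product_delete[OF assms(1) b] x CM unfolding T_def by blast
qed

end
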